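(* Let $(V,T,\Theta)$ be a representation of a difference Lie group $(G,\mathcal{D})$. Then $\big(\bigoplus_{n\ge 1}C^n(G,\mathcal{D},V,T),\delta\big)$ is a cochain complex, i.e. $\delta\circ\delta=0$.
   Context: A difference operator on a Lie group $G$ is a smooth map $\mathcal{D}:G\to G$ with $\mathcal{D}(gh)=\mathcal{D}(g)\,g\,\mathcal{D}(h)\,g^{-1}$ for all $g,h\in G$; the pair $(G,\mathcal{D})$ is called a difference Lie group. A representation $(V,T,\Theta)$ of $(G,\mathcal{D})$ consists of a finite-dimensional real vector space $V$, a linear map $T:V\to V$ and a Lie group homomorphism $\Theta:G\to GL(V)$ such that $T(\Theta(g)u)+\Theta(g)u=\Theta(\mathcal{D}(g)g)T(u)+\Theta(\mathcal{D}(g)g)u$ for all $g\in G$, $u\in V$. Then $\Theta_{\mathcal{D}}:G\to GL(V)$, $\Theta_{\mathcal{D}}(g)=\Theta(\mathcal{D}(g)g)$, is also a representation of the Lie group $G$ on $V$. Normalized cochains: for $n\ge1$, $C^n(G,V)$ is the space of smooth maps $\alpha_n:G^n\to V$ with $\alpha_n(g_1,\dots,g_n)=0$ whenever some $g_i=e_G$. For a representation $\Theta$ of $G$ on $V$, the coboundary operator $\mathrm{d}^{\Theta}:C^n(G,V)\to C^{n+1}(G,V)$ is $$\mathrm{d}^{\Theta}(\alpha_n)(g_1,\dots,g_{n+1})=\Theta(g_1)\alpha_n(g_2,\dots,g_{n+1})+\sum_{i=1}^n(-1)^i\alpha_n(g_1,\dots,g_{i-1},g_ig_{i+1},g_{i+2},\dots,g_{n+1})+(-1)^{n+1}\alpha_n(g_1,\dots,g_n),$$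 and $\mathrm{d}^{\Theta_{\mathcal{D}}}$ is defined by the same formula with $\Theta_{\mathcal{D}}$ in place of $\Theta$. Put $\mathfrak{C}^1(\mathcal{D},T)=0$ and $\mathfrak{C}^n(\mathcal{D},T)=C^{n-1}(G,V)$ for $n\ge2$. Put $C^1(G,\mathcal{D},V,T)=C^1(G,V)$ and $C^n(G,\mathcal{D},V,T)=C^n(G,V)\oplus\mathfrak{C}^n(\mathcal{D},T)$ for $n\ge2$. The operator $\delta:C^n(G,\mathcal{D},V,T)\to C^{n+1}(G,\mathcal{D},V,T)$ is $$\delta(\alpha_n,\beta_{n-1})=\big(\mathrm{d}^{\Theta}\alpha_n,\ \mathrm{d}^{\Theta_{\mathcal{D}}}\beta_{n-1}+\mathfrak{K}(\alpha_n)\big)$$ (with no $\beta$-component when $n=1$), where $\mathfrak{K}:C^n(G,V)\to\mathfrak{C}^{n+1}(\mathcal{D},T)=C^n(G,V)$ is $\mathfrak{K}=\mathfrak{K}'+\widehat{\mathfrak{K}}$ with $$\mathfrak{K}'(\alpha_1)(g_1)=-\Theta(\mathcal{D}(g_1))\alpha_1(g_1)+\alpha_1(\mathcal{D}(g_1)g_1)-\alpha_1(\mathcal{D}(g_1)),$$ $$\mathfrak{K}'(\alpha_2)(g_1,g_2)=\alpha_2(\mathcal{D}(g_1),g_1)-\alpha_2(\mathcal{D}(g_1g_2),g_1g_2)+\Theta(\mathcal{D}(g_1)g_1)\alpha_2(\mathcal{D}(g_2),g_2),$$ $\mathfrak{K}'(\alpha_n)=0$ for $n\ge3$, and for all $n\ge1$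 $$\widehat{\mathfrak{K}}(\alpha_n)(g_1,\dots,g_n)=(-1)^n\Big(\alpha_n(\mathcal{D}(g_1)g_1,\dots,\mathcal{D}(g_n)g_n)-T(\alpha_n(g_1,\dots,g_n))-\alpha_n(g_1,\dots,g_n)\Big).$$ *)

theory Defs
  imports
    "HOL-Analysis.Analysis"
    "HOL-Library.Function_Algebras"
    "HOL-Algebra.Group"
begin

section \<open>Functions with values in a real vector space\<close>

instantiation "fun" :: (type, real_vector) real_vector
begin

definition scaleR_fun :: "real \<Rightarrow> ('a \<Rightarrow> 'b) \<Rightarrow> 'a \<Rightarrow> 'b"
  where "scaleR_fun c f = (\<lambda>x. c *\<^sub>R f x)"

instance
  by standard (auto simp: scaleR_fun_def fun_eq_iff scaleR_add_right scaleR_add_left)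

end

section \<open>Smooth manifolds\<close>

text \<open>
  The number \<open>n\<close> of arguments of a cochain varies inside the statement, so the dimension of a
  manifold has to be a natural number rather than a type.  Charts therefore take values in
  \<^const>\<open>Euclidean_space\<close>, the library's $R^d$ with \<open>d :: nat\<close>, whose points are the sequences
  \<open>x :: nat \<Rightarrow> real\<close> with \<open>x i = 0\<close> for all \<open>i \<ge> d\<close>.

  \<open>Ck_on N k S f\<close>: on the open set \<open>S\<close> of $R^N$, all partial derivatives of \<open>f\<close> up to order \<open>k\<close>
  exist and are continuous.
\<close>

fun Ck_on :: "nat \<Rightarrow> nat \<Rightarrow> (nat \<Rightarrow> real) set \<Rightarrow> ((nat \<Rightarrow> real) \<Rightarrow> 'v::real_normed_vector) \<Rightarrow> bool"
  where
    "Ck_on N 0 S f \<longleftrightarrow> continuous_map (subtopology (Euclidean_space N) S) euclidean f"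
  | "Ck_on N (Suc k) S f \<longleftrightarrow>
       continuous_map (subtopology (Euclidean_space N) S) euclidean f \<and>
       (\<forall>i<N. \<exists>f'. (\<forall>x\<in>S. ((\<lambda>t. f (x(i := t))) has_vector_derivative f' x) (at (x i))) \<and>
                    Ck_on N k S f')"

definition Cinf_on :: "nat \<Rightarrow> (nat \<Rightarrow> real) set \<Rightarrow> ((nat \<Rightarrow> real) \<Rightarrow> 'v::real_normed_vector) \<Rightarrow> bool"
  where "Cinf_on N S f \<longleftrightarrow> (\<forall>k. Ck_on N k S f)"

text \<open>A chart \<open>(U, \<phi>)\<close> consists of its domain and its coordinate map; the values of \<open>\<phi>\<close> outside
  \<open>U\<close> are irrelevant.\<close>

type_synonym 'a chart = "'a set \<times> ('a \<Rightarrow> nat \<Rightarrow> real)"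

record 'a manifold =
  mtop :: "'a topology"
  mdim :: nat
  matlas :: "'a chart set"

definition is_chart :: "'a topology \<Rightarrow> nat \<Rightarrow> 'a chart \<Rightarrow> bool"
  where "is_chart X d c \<longleftrightarrow> (case c of (U, \<phi>) \<Rightarrow>
    openin X U \<and> openin (Euclidean_space d) (\<phi> ` U) \<and>
    homeomorphic_map (subtopology X U) (subtopology (Euclidean_space d) (\<phi> ` U)) \<phi>)"

definition smooth_compatible :: "nat \<Rightarrow> 'a chart \<Rightarrow> 'a chart \<Rightarrow> bool"
  where "smooth_compatible d c c' \<longleftrightarrow> (case c of (U, \<phi>) \<Rightarrow> case c' of (V, \<psi>) \<Rightarrow>
    \<forall>j<d. Cinf_on d (\<phi> ` (U \<inter> V)) (\<lambda>x. \<psi> (inv_into U \<phi> x) j))"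

definition smooth_manifold :: "'a manifold \<Rightarrow> bool"
  where "smooth_manifold M \<longleftrightarrow>
    Hausdorff_space (mtop M) \<and> second_countable (mtop M) \<and>
    (\<forall>c\<in>matlas M. is_chart (mtop M) (mdim M) c) \<and>
    (\<Union>(fst ` matlas M) = topspace (mtop M)) \<and>
    (\<forall>c\<in>matlas M. \<forall>c'\<in>matlas M. smooth_compatible (mdim M) c c')"

definition smooth_map :: "'a manifold \<Rightarrow> 'b manifold \<Rightarrow> ('a \<Rightarrow> 'b) \<Rightarrow> bool"
  where "smooth_map M N f \<longleftrightarrow>
    continuous_map (mtop M) (mtop N) f \<and>
    (\<forall>(U, \<phi>)\<in>matlas M. \<forall>(V, \<psi>)\<in>matlas N. \<forall>j<mdim N.
       Cinf_on (mdim M) (\<phi> ` (U \<inter> f -` V)) (\<lambda>x. \<psi> (f (inv_into U \<phi> x)) j))"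

definition smooth_vec :: "'a manifold \<Rightarrow> ('a \<Rightarrow> 'v::real_normed_vector) \<Rightarrow> bool"
  where "smooth_vec M f \<longleftrightarrow>
    (\<forall>(U, \<phi>)\<in>matlas M. Cinf_on (mdim M) (\<phi> ` U) (\<lambda>x. f (inv_into U \<phi> x)))"

text \<open>
  The $n$-fold product manifold $M^n$.  Its points are the tuples $(g_1,\dots,g_n)$, encoded as
  functions on \<open>{1..n}\<close> that are \<open>undefined\<close> elsewhere.  The product of charts
  $\varphi_1,\dots,\varphi_n$ concatenates the coordinates: block \<open>k div d + 1\<close>, position
  \<open>k mod d\<close>.
\<close>

definition product_chart :: "nat \<Rightarrow> nat \<Rightarrow> (nat \<Rightarrow> 'a chart) \<Rightarrow> (nat \<Rightarrow> 'a) chart"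
  where "product_chart d n c =
    (PiE {1..n} (\<lambda>i. fst (c i)),
     \<lambda>g k. if k < n * d then snd (c (k div d + 1)) (g (k div d + 1)) (k mod d) else 0)"

definition power_manifold :: "'a manifold \<Rightarrow> nat \<Rightarrow> (nat \<Rightarrow> 'a) manifold"
  where "power_manifold M n =
    \<lparr> mtop = product_topology (\<lambda>_. mtop M) {1..n},
      mdim = n * mdim M,
      matlas = product_chart (mdim M) n ` (PiE {1..n} (\<lambda>_. matlas M)) \<rparr>"

section \<open>Difference Lie groups and their representations\<close>

locale lie_group = group G for G :: "('g, 'm) monoid_scheme" (structure) +
  fixes M :: "'g manifold"
  assumes manifold: "smooth_manifold M"
    and topspace_eq: "topspace (mtop M) = carrier G"
    and smooth_mult: "smooth_map (power_manifold M 2) M (\<lambda>g. g 1 \<otimes> g 2)"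
    and smooth_inv: "smooth_map M M (\<lambda>g. inv g)"

locale difference_lie_group = lie_group G M
  for G :: "('g, 'm) monoid_scheme" (structure) and M :: "'g manifold" +
  fixes D :: "'g \<Rightarrow> 'g"
  assumes smooth_D: "smooth_map M M D"
    and difference:
      "\<lbrakk>g \<in> carrier G; h \<in> carrier G\<rbrakk> \<Longrightarrow> D (g \<otimes> h) = D g \<otimes> g \<otimes> D h \<otimes> inv g"

text \<open>
  A finite-dimensional real vector space is a normed space spanned by a finite set; the norm only
  serves to speak about smoothness, which does not depend on its choice.  Every endomorphism is
  bounded then, so \<open>'v \<Rightarrow>\<^sub>L 'v\<close> is the space of all endomorphisms.  The Lie group
  $GL(V)$ is an open submanifold of it: smoothness into $GL(V)$ is smoothness into
  \<open>'v \<Rightarrow>\<^sub>L 'v\<close>.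
\<close>

definition GL :: "('v::real_normed_vector \<Rightarrow>\<^sub>L 'v) monoid"
  where "GL = \<lparr> carrier = {A. \<exists>B. A o\<^sub>L B = id_blinfun \<and> B o\<^sub>L A = id_blinfun},
                monoid.mult = (o\<^sub>L), one = id_blinfun \<rparr>"

definition twisted_rep :: "('g, 'm) monoid_scheme \<Rightarrow> ('g \<Rightarrow> 'g) \<Rightarrow> ('g \<Rightarrow> 'w) \<Rightarrow> 'g \<Rightarrow> 'w"
  where "twisted_rep G D \<Theta> g = \<Theta> (D g \<otimes>\<^bsub>G\<^esub> g)"

locale difference_representation = difference_lie_group G M D
  for G :: "('g, 'm) monoid_scheme" (structure) and M :: "'g manifold" and D :: "'g \<Rightarrow> 'g" +
  fixes T :: "'v::real_normed_vector \<Rightarrow> 'v"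
    and \<Theta> :: "'g \<Rightarrow> ('v \<Rightarrow>\<^sub>L 'v)"
  assumes finite_dim: "\<exists>B :: 'v set. finite B \<and> span B = UNIV"
    and linear_T: "linear T"
    and hom_rep: "\<Theta> \<in> hom G GL"
    and smooth_rep: "smooth_vec M \<Theta>"
    and compat: "g \<in> carrier G \<Longrightarrow>
      T (blinfun_apply (\<Theta> g) u) + blinfun_apply (\<Theta> g) u =
      blinfun_apply (\<Theta> (D g \<otimes> g)) (T u) + blinfun_apply (\<Theta> (D g \<otimes> g)) u"

section \<open>The cochain complex\<close>

text \<open>A map on $G^n$ is represented by the function that is \<open>0\<close> outside $G^n$, so that equality
  of cochains is equality of functions.\<close>

definition tuples :: "('g, 'm) monoid_scheme \<Rightarrow> nat \<Rightarrow> (nat \<Rightarrow> 'g) set"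
  where "tuples G n = PiE {1..n} (\<lambda>_. carrier G)"

definition tup :: "'g list \<Rightarrow> nat \<Rightarrow> 'g"
  where "tup xs = (\<lambda>i\<in>{1..length xs}. xs ! (i - 1))"

definition cochains ::
    "('g, 'm) monoid_scheme \<Rightarrow> 'g manifold \<Rightarrow> nat \<Rightarrow> ((nat \<Rightarrow> 'g) \<Rightarrow> 'v::real_normed_vector) set"
  where "cochains G M n = {\<alpha>.
    smooth_vec (power_manifold M n) \<alpha> \<and>
    (\<forall>g\<in>tuples G n. (\<exists>i\<in>{1..n}. g i = \<one>\<^bsub>G\<^esub>) \<longrightarrow> \<alpha> g = 0) \<and>
    (\<forall>g. g \<notin> tuples G n \<longrightarrow> \<alpha> g = 0)}"

definition coboundary ::
    "('g, 'm) monoid_scheme \<Rightarrow> ('g \<Rightarrow> ('v::real_normed_vector \<Rightarrow>\<^sub>L 'v)) \<Rightarrow> nat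
      \<Rightarrow> ((nat \<Rightarrow> 'g) \<Rightarrow> 'v) \<Rightarrow> (nat \<Rightarrow> 'g) \<Rightarrow> 'v"
  where "coboundary G \<Theta> n \<alpha> g =
    (if g \<in> tuples G (n + 1) then
       blinfun_apply (\<Theta> (g 1)) (\<alpha> (\<lambda>j\<in>{1..n}. g (j + 1)))
       + (\<Sum>i=1..n. (-1) ^ i *\<^sub>R
            \<alpha> (\<lambda>j\<in>{1..n}. if j < i then g j
                           else if j = i then g i \<otimes>\<^bsub>G\<^esub> g (i + 1)
                           else g (j + 1)))
       + (-1) ^ (n + 1) *\<^sub>R \<alpha> (\<lambda>j\<in>{1..n}. g j)
     else 0)"

definition K_prime ::
    "('g, 'm) monoid_scheme \<Rightarrow> ('g \<Rightarrow> 'g) \<Rightarrow> ('g \<Rightarrow> ('v::real_normed_vector \<Rightarrow>\<^sub>L 'v)) \<Rightarrow> nat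
      \<Rightarrow> ((nat \<Rightarrow> 'g) \<Rightarrow> 'v) \<Rightarrow> (nat \<Rightarrow> 'g) \<Rightarrow> 'v"
  where "K_prime G D \<Theta> n \<alpha> g =
    (if g \<in> tuples G n then
       if n = 1 then
         - blinfun_apply (\<Theta> (D (g 1))) (\<alpha> (tup [g 1]))
         + \<alpha> (tup [D (g 1) \<otimes>\<^bsub>G\<^esub> g 1]) - \<alpha> (tup [D (g 1)])
       else if n = 2 then
         \<alpha> (tup [D (g 1), g 1])
         - \<alpha> (tup [D (g 1 \<otimes>\<^bsub>G\<^esub> g 2), g 1 \<otimes>\<^bsub>G\<^esub> g 2])
         + blinfun_apply (\<Theta> (D (g 1) \<otimes>\<^bsub>G\<^esub> g 1)) (\<alpha> (tup [D (g 2), g 2]))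
       else 0
     else 0)"

definition K_hat ::
    "('g, 'm) monoid_scheme \<Rightarrow> ('g \<Rightarrow> 'g) \<Rightarrow> ('v::real_normed_vector \<Rightarrow> 'v) \<Rightarrow> nat
      \<Rightarrow> ((nat \<Rightarrow> 'g) \<Rightarrow> 'v) \<Rightarrow> (nat \<Rightarrow> 'g) \<Rightarrow> 'v"
  where "K_hat G D T n \<alpha> g =
    (if g \<in> tuples G n then
       (-1) ^ n *\<^sub>R (\<alpha> (\<lambda>i\<in>{1..n}. D (g i) \<otimes>\<^bsub>G\<^esub> g i) - T (\<alpha> g) - \<alpha> g)
     else 0)"

definition K_map ::
    "('g, 'm) monoid_scheme \<Rightarrow> ('g \<Rightarrow> 'g) \<Rightarrow> ('v::real_normed_vector \<Rightarrow> 'v)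
      \<Rightarrow> ('g \<Rightarrow> ('v \<Rightarrow>\<^sub>L 'v)) \<Rightarrow> nat \<Rightarrow> ((nat \<Rightarrow> 'g) \<Rightarrow> 'v) \<Rightarrow> (nat \<Rightarrow> 'g) \<Rightarrow> 'v"
  where "K_map G D T \<Theta> n \<alpha> = K_prime G D \<Theta> n \<alpha> + K_hat G D T n \<alpha>"

text \<open>\<open>second_cochains\<close> is $\mathfrak{C}^n(\mathcal{D},T)$.  In degree \<open>1\<close> the cochain
  \<open>\<alpha>\<close> is identified with the pair \<open>(\<alpha>, 0)\<close>.\<close>

definition second_cochains ::
    "('g, 'm) monoid_scheme \<Rightarrow> 'g manifold \<Rightarrow> nat \<Rightarrow> ((nat \<Rightarrow> 'g) \<Rightarrow> 'v::real_normed_vector) set"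
  where "second_cochains G M n = (if n = 1 then {0} else cochains G M (n - 1))"

definition difference_cochains ::
    "('g, 'm) monoid_scheme \<Rightarrow> 'g manifold \<Rightarrow> nat
      \<Rightarrow> (((nat \<Rightarrow> 'g) \<Rightarrow> 'v::real_normed_vector) \<times> ((nat \<Rightarrow> 'g) \<Rightarrow> 'v)) set"
  where "difference_cochains G M n = cochains G M n \<times> second_cochains G M n"

definition difference_coboundary ::
    "('g, 'm) monoid_scheme \<Rightarrow> ('g \<Rightarrow> 'g) \<Rightarrow> ('v::real_normed_vector \<Rightarrow> 'v)
      \<Rightarrow> ('g \<Rightarrow> ('v \<Rightarrow>\<^sub>L 'v)) \<Rightarrow> nat
      \<Rightarrow> ((nat \<Rightarrow> 'g) \<Rightarrow> 'v) \<times> ((nat \<Rightarrow> 'g) \<Rightarrow> 'v)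
      \<Rightarrow> ((nat \<Rightarrow> 'g) \<Rightarrow> 'v) \<times> ((nat \<Rightarrow> 'g) \<Rightarrow> 'v)"
  where "difference_coboundary G D T \<Theta> n = (\<lambda>(\<alpha>, \<beta>).
    (coboundary G \<Theta> n \<alpha>,
     if n = 1 then K_map G D T \<Theta> n \<alpha>
     else coboundary G (twisted_rep G D \<Theta>) (n - 1) \<beta> + K_map G D T \<Theta> n \<alpha>))"

text \<open>Cochain complexes of real vector spaces graded by the degrees \<open>n \<ge> 1\<close>; every \<open>C n\<close> is a
  subspace of one ambient space.\<close>

definition cochain_complex :: "(nat \<Rightarrow> 'a::real_vector set) \<Rightarrow> (nat \<Rightarrow> 'a \<Rightarrow> 'a) \<Rightarrow> bool"
  where "cochain_complex C \<delta> \<longleftrightarrow> (\<forall>n\<ge>1.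
    subspace (C n) \<and>
    \<delta> n ` C n \<subseteq> C (n + 1) \<and>
    (\<forall>x\<in>C n. \<forall>y\<in>C n. \<delta> n (x + y) = \<delta> n x + \<delta> n y) \<and>
    (\<forall>c. \<forall>x\<in>C n. \<delta> n (c *\<^sub>R x) = c *\<^sub>R \<delta> n x) \<and>
    (\<forall>x\<in>C n. \<delta> (n + 1) (\<delta> n x) = 0))"

end

theory Submission
  imports Defs
begin

text \<open>
  Write \<open>\<psi> g = D g \<otimes> g\<close>, an endomorphism of \<open>G\<close>, and \<open>(\<iota> \<alpha>) g = \<alpha> (D g, g)\<close>.  Then
  $\mathfrak{K}'$ is \<open>- \<iota> \<circ> d\<close> in degree 1 and $d_{\mathcal{D}} \circ \iota$ in degree 2, so its contribution
  to $\delta\circ\delta$ telescopes to $d_{\mathcal{D}} \circ d_{\mathcal{D}} = 0$.  Up to the sign $(-1)^n$,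
  $\widehat{\mathfrak{K}}$ is the map $E\alpha = \alpha \circ \psi^n - T\alpha - \alpha$, and the compatibility of
  \<open>T\<close> with \<open>\<Theta>\<close> says precisely that $d_{\mathcal{D}} \circ E = E \circ d$.  That $\delta$ preserves
  smoothness rests on the chain rule in charts.
\<close>

section \<open>Differential calculus in coordinates\<close>

text \<open>Let \<iota> be an operator of degree -1 that vanishes except on 2-cochains. Then K' =
  \<open>d\<^sub>D\<close> \<iota> - \<iota> d holds in every degree: the three cases defining K'
  form a single homotopy formula, and \<open>d\<^sub>D\<close> K' + K' d = 0 because both
  coboundaries square to zero. The operator \<delta> is the differential of a cone. The diagonal
  entries of \<delta> \<circ> \<delta> are squares of group coboundaries, and the one remaining
  entry is \<open>d\<^sub>D\<close> K + K d; the sign (-1)^n turns commutation with E into the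
  anticommutation required there.

  The analytic obstacle is that charts take values in \<open>nat \<Rightarrow> real\<close>, which
  carries a product topology and no norm, so \<open>has_derivative\<close> does not apply to
  functions of chart coordinates. The chain rule has to come from partial derivatives alone, along
  curves in one real variable. The other obstacle is V, an arbitrary normed space spanned by a
  finite set: boundedness of \<open>T\<close>, on which smoothness of
  \<open>T \<circ> \<alpha>\<close> rests, takes a compactness argument.\<close>

lemma Euclidean_space_eq_top_of_set:
  "Euclidean_space N = top_of_set {x. \<forall>i\<ge>N. x i = 0}"
  by (simp add: Euclidean_space_def euclidean_product_topology)

lemma openin_Euclidean_space_obtain:
  assumes "openin (Euclidean_space N) S"
  obtains O' where "open O'" "S = {x. \<forall>i\<ge>N. x i = 0} \<inter> O'"
  using assms unfolding Euclidean_space_eq_top_of_set openin_open by blast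

lemma openin_Euclidean_space_subset:
  "openin (Euclidean_space N) S \<Longrightarrow> x \<in> S \<Longrightarrow> N \<le> i \<Longrightarrow> x i = 0"
  using openin_subset[of "Euclidean_space N" S] by (auto simp: topspace_Euclidean_space)

lemma continuous_on_fun_upd: "continuous_on A (\<lambda>t. (x :: nat \<Rightarrow> real)(i := t))"
proof (rule continuous_on_coordinatewise_then_product)
  show "continuous_on A (\<lambda>t. (x(i := t)) j)" for j
    by (cases "j = i") simp_all
qed

lemma openin_Euclidean_space_line:
  assumes "openin (Euclidean_space N) S" "x \<in> S" "i < N"
  shows "open {t. x(i := t) \<in> S}"
proof -
  obtain O' where O: "open O'" "S = {x. \<forall>i\<ge>N. x i = 0} \<inter> O'"
    using assms(1) by (rule openin_Euclidean_space_obtain)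
  have "{t. x(i := t) \<in> S} = (\<lambda>t. x(i := t)) -` O'"
    using O assms by auto
  then show ?thesis
    using O continuous_on_fun_upd[of UNIV x i] by (simp add: open_vimage)
qed

lemma continuous_map_Euclidean_space_subtopology_iff:
  assumes "openin (Euclidean_space N) S"
  shows "continuous_map (subtopology (Euclidean_space N) S) euclidean f \<longleftrightarrow> continuous_on S f"
proof -
  have "S \<subseteq> {x. \<forall>i\<ge>N. x i = 0}"
    using assms openin_Euclidean_space_subset by blast
  then show ?thesis
    by (simp add: Euclidean_space_eq_top_of_set subtopology_subtopology Int_absorb1)
qed

section \<open>C^k functions: restriction, change of values, gluing\<close>

lemma Ck_on_imp_continuous_on:
  "Ck_on N k S f \<Longrightarrow> openin (Euclidean_space N) S \<Longrightarrow> continuous_on S f"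
  by (cases k) (auto simp: continuous_map_Euclidean_space_subtopology_iff)

text \<open>Derivatives are taken in the full coordinate line rather than within the set, so a
  smaller set only drops requirements.\<close>

lemma Ck_on_subset: "Ck_on N k S f \<Longrightarrow> S' \<subseteq> S \<Longrightarrow> Ck_on N k S' f"
proof (induction k arbitrary: f)
  case 0
  then show ?case
    by (auto intro: continuous_map_from_subtopology_mono)
next
  case (Suc k)
  then show ?case
    by (simp) (meson continuous_map_from_subtopology_mono subsetD)
qed

lemma Ck_on_SucE:
  assumes "Ck_on N (Suc k) S f" "i < N"
  obtains f' where "\<And>x. x \<in> S \<Longrightarrow> ((\<lambda>t. f (x(i := t))) has_vector_derivative f' x) (at (x i))"
    "Ck_on N k S f'"
proof -
  have "\<exists>f'. (\<forall>x\<in>S. ((\<lambda>t. f (x(i := t))) has_vector_derivative f' x) (at (x i))) \<and> Ck_on N k S f'"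
    using assms by simp
  then show ?thesis using that by blast
qed

lemma Ck_on_SucD: "Ck_on N (Suc k) S f \<Longrightarrow> Ck_on N k S f"
proof (induction k arbitrary: f)
  case (Suc k)
  show ?case
    unfolding Ck_on.simps(2)[of N k]
  proof (intro conjI allI impI)
    show "continuous_map (subtopology (Euclidean_space N) S) euclidean f"
      using Suc.prems by simp
    fix i assume "i < N"
    show "\<exists>f'. (\<forall>x\<in>S. ((\<lambda>t. f (x(i := t))) has_vector_derivative f' x) (at (x i))) \<and> Ck_on N k S f'"
      using Ck_on_SucE[OF Suc.prems \<open>i < N\<close>] Suc.IH by metis
  qed
qed simp

text \<open>Agreement on \<open>S\<close> transfers derivatives \<open>at (x i)\<close> because a
  coordinate line meets the open set \<open>S\<close> in an open set of parameters.\<close>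

lemma Ck_on_cong:
  assumes "Ck_on N k S f" "openin (Euclidean_space N) S" "\<And>x. x \<in> S \<Longrightarrow> f x = g x"
  shows "Ck_on N k S g"
proof -
  have cont: "continuous_on S g"
    using Ck_on_imp_continuous_on[OF assms(1,2)] assms(3) by (simp cong: continuous_on_cong)
  show ?thesis
  proof (cases k)
    case 0
    then show ?thesis
      using cont assms by (simp add: continuous_map_Euclidean_space_subtopology_iff)
  next
    case (Suc l)
    have "\<exists>f'. (\<forall>x\<in>S. ((\<lambda>t. g (x(i := t))) has_vector_derivative f' x) (at (x i))) \<and>
               Ck_on N l S f'" if "i < N" for i
    proof -
      obtain f' where f': "\<And>x. x \<in> S \<Longrightarrow> ((\<lambda>t. f (x(i := t))) has_vector_derivative f' x) (at (x i))"
        "Ck_on N l S f'"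
        using Ck_on_SucE[OF assms(1)[unfolded Suc] \<open>i < N\<close>] by metis
      have "((\<lambda>t. g (x(i := t))) has_vector_derivative f' x) (at (x i))" if "x \<in> S" for x
        using f'(1)[OF that]
        by (rule has_vector_derivative_transform_within_open
            [OF _ openin_Euclidean_space_line[OF assms(2) that \<open>i < N\<close>]])
          (use that assms(3) in auto)
      with f'(2) show ?thesis by blast
    qed
    with cont assms show ?thesis
      unfolding Suc by (simp add: continuous_map_Euclidean_space_subtopology_iff)
  qed
qed

text \<open>The derivative in a fixed direction is unique, so the local partial derivatives glue.\<close>

lemma Ck_on_locally:
  assumes "openin (Euclidean_space N) S"
    and "\<And>x. x \<in> S \<Longrightarrow> \<exists>W. openin (Euclidean_space N) W \<and> x \<in> W \<and> W \<subseteq> S \<and> Ck_on N k W f"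
  shows "Ck_on N k S f"
  using assms(2)
proof (induction k arbitrary: f)
  case 0
  have "continuous_on S f"
  proof (rule continuous_on_eq_continuous_within[THEN iffD2], rule ballI)
    fix x assume "x \<in> S"
    then obtain W where W: "openin (Euclidean_space N) W" "x \<in> W" "W \<subseteq> S" "Ck_on N 0 W f"
      using "0.prems" by meson
    have "continuous_on W f"
      using W(4,1) by (rule Ck_on_imp_continuous_on)
    then have "continuous (at x within W) f"
      using W(2) by (simp add: continuous_on_eq_continuous_within)
    \<comment> \<open>\<open>W\<close> is open in the coordinate space, hence also relative to
      \<open>S\<close>, so both sets look the same near \<open>x\<close>.\<close>
    moreover have "at x within W = at x within S"
    proof -
      obtain A where "open A" "W = {x. \<forall>i\<ge>N. x i = 0} \<inter> A"
        using W(1) by (rule openin_Euclidean_space_obtain)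
      moreover have "S \<subseteq> {x. \<forall>i\<ge>N. x i = 0}"
        using assms(1) openin_Euclidean_space_subset by blast
      ultimately have "open A" "x \<in> A" "W \<inter> A - {x} = S \<inter> A - {x}"
        using W(2,3) by auto
      then show ?thesis
        by (intro at_within_nhd)
    qed
    ultimately show "continuous (at x within S) f" by simp
  qed
  then show ?case
    using assms(1) by (simp add: continuous_map_Euclidean_space_subtopology_iff)
next
  case (Suc k)
  have cont: "Ck_on N k S f"
    using Suc.prems by (intro Suc.IH) (meson Ck_on_SucD)
  have "\<exists>f'. (\<forall>x\<in>S. ((\<lambda>t. f (x(i := t))) has_vector_derivative f' x) (at (x i))) \<and>
             Ck_on N k S f'" if i: "i < N" for i
  proof (intro exI conjI ballI)
    let ?f' = "\<lambda>x. vector_derivative (\<lambda>t. f (x(i := t))) (at (x i))"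
    have *: "\<exists>W. openin (Euclidean_space N) W \<and> x \<in> W \<and> W \<subseteq> S \<and> Ck_on N k W ?f' \<and>
        ((\<lambda>t. f (x(i := t))) has_vector_derivative ?f' x) (at (x i))" if x: "x \<in> S" for x
    proof -
      obtain W where W0: "openin (Euclidean_space N) W" "x \<in> W" "W \<subseteq> S" "Ck_on N (Suc k) W f"
        using Suc.prems[OF x] by meson
      obtain f' where f': "\<And>x. x \<in> W \<Longrightarrow> ((\<lambda>t. f (x(i := t))) has_vector_derivative f' x) (at (x i))"
        "Ck_on N k W f'"
        using Ck_on_SucE[OF W0(4) i] by metis
      note W = W0(1-3) f'
      have "f' y = ?f' y" if "y \<in> W" for y
        using W(4)[OF that] by (simp add: vector_derivative_at)
      then have "Ck_on N k W ?f'" "((\<lambda>t. f (x(i := t))) has_vector_derivative ?f' x) (at (x i))"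
        using Ck_on_cong[OF W(5,1)] W(2) W(4)[OF W(2)] by auto
      with W(1-3) show ?thesis by (intro exI conjI)
    qed
    show "Ck_on N k S ?f'"
      using * by (intro Suc.IH) meson
    show "((\<lambda>t. f (x(i := t))) has_vector_derivative ?f' x) (at (x i))" if "x \<in> S" for x
      using *[OF that] by blast
  qed
  moreover have "continuous_on S f"
    using cont assms(1) Ck_on_imp_continuous_on by blast
  ultimately show ?case
    using assms(1) by (simp add: continuous_map_Euclidean_space_subtopology_iff)
qed

section \<open>Linear and bilinear operations on C^k functions\<close>

lemma Ck_on_const: "Ck_on N k S (\<lambda>x. c)"
proof (induction k arbitrary: c)
  case (Suc k)
  have "\<exists>f'. (\<forall>x\<in>S. ((\<lambda>t. c) has_vector_derivative f' x) (at (x i))) \<and> Ck_on N k S f'" for i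
    using Suc.IH[of 0] by (intro exI[of _ "\<lambda>x. 0"]) simp
  then show ?case by simp
qed simp

lemma Ck_on_coordinate:
  assumes "openin (Euclidean_space N) S"
  shows "Ck_on N k S (\<lambda>x. x j)"
proof -
  have cont: "continuous_on S (\<lambda>x. x j)"
    by (rule continuous_on_subset[OF continuous_on_product_coordinates]) simp
  show ?thesis
  proof (cases k)
    case 0
    with cont assms show ?thesis by (simp add: continuous_map_Euclidean_space_subtopology_iff)
  next
    case (Suc l)
    have "\<exists>f'. (\<forall>x\<in>S. ((\<lambda>t. (x(i := t)) j) has_vector_derivative f' x) (at (x i))) \<and>
               Ck_on N l S f'" if "i < N" for i
      by (cases "i = j"; intro exI[of _ "\<lambda>x. if i = j then 1 else 0"])
        (auto simp: Ck_on_const)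
    with cont assms show ?thesis
      unfolding Suc by (simp add: continuous_map_Euclidean_space_subtopology_iff)
  qed
qed

lemma Ck_on_bounded_linear:
  assumes "bounded_linear L" "openin (Euclidean_space N) S" "Ck_on N k S f"
  shows "Ck_on N k S (\<lambda>x. L (f x))"
  using assms(3)
proof (induction k arbitrary: f)
  case 0
  then show ?case
    using bounded_linear.continuous_on[OF assms(1)]
    by (simp add: continuous_map_Euclidean_space_subtopology_iff[OF assms(2)])
next
  case (Suc k)
  have "continuous_on S (\<lambda>x. L (f x))"
    using Ck_on_imp_continuous_on[OF Suc.prems assms(2)] assms(1) bounded_linear.continuous_on
    by blast
  moreover have "\<exists>f'. (\<forall>x\<in>S. ((\<lambda>t. L (f (x(i := t)))) has_vector_derivative f' x) (at (x i))) \<and>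
             Ck_on N k S f'" if i: "i < N" for i
  proof -
    obtain f' where "\<And>x. x \<in> S \<Longrightarrow> ((\<lambda>t. f (x(i := t))) has_vector_derivative f' x) (at (x i))"
      "Ck_on N k S f'"
      using Ck_on_SucE[OF Suc.prems i] by metis
    then show ?thesis
      using Suc.IH bounded_linear.has_vector_derivative[OF assms(1)]
      by (intro exI[of _ "\<lambda>x. L (f' x)"]) auto
  qed
  ultimately show ?case
    using assms(2) by (simp add: continuous_map_Euclidean_space_subtopology_iff)
qed

lemma Ck_on_add:
  assumes "openin (Euclidean_space N) S" "Ck_on N k S f" "Ck_on N k S g"
  shows "Ck_on N k S (\<lambda>x. f x + g x)"
  using assms(2,3)
proof (induction k arbitrary: f g)
  case 0
  then show ?case
    using assms(1)
    by (simp add: continuous_map_Euclidean_space_subtopology_iff continuous_on_add)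
next
  case (Suc k)
  have "continuous_on S (\<lambda>x. f x + g x)"
    using Suc.prems assms(1) by (intro continuous_intros Ck_on_imp_continuous_on)
  moreover have "\<exists>f'. (\<forall>x\<in>S. ((\<lambda>t. f (x(i := t)) + g (x(i := t))) has_vector_derivative f' x) (at (x i))) \<and>
             Ck_on N k S f'" if i: "i < N" for i
  proof -
    obtain f' g' where "\<And>x. x \<in> S \<Longrightarrow> ((\<lambda>t. f (x(i := t))) has_vector_derivative f' x) (at (x i))"
      "Ck_on N k S f'"
      "\<And>x. x \<in> S \<Longrightarrow> ((\<lambda>t. g (x(i := t))) has_vector_derivative g' x) (at (x i))"
      "Ck_on N k S g'"
      using Ck_on_SucE[OF Suc.prems(1) i] Ck_on_SucE[OF Suc.prems(2) i] by metis
    then show ?thesis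
      using Suc.IH by (intro exI[of _ "\<lambda>x. f' x + g' x"]) (auto intro: has_vector_derivative_add)
  qed
  ultimately show ?case
    using assms(1) by (simp add: continuous_map_Euclidean_space_subtopology_iff)
qed

lemma Ck_on_sum:
  assumes "openin (Euclidean_space N) S" "\<And>i. i \<in> I \<Longrightarrow> Ck_on N k S (f i)"
  shows "Ck_on N k S (\<lambda>x. \<Sum>i\<in>I. f i x)"
  using assms(2)
proof (induction I rule: infinite_finite_induct)
  case (insert i I)
  then have "Ck_on N k S (\<lambda>x. f i x + (\<Sum>i\<in>I. f i x))"
    by (intro Ck_on_add[OF assms(1)]) auto
  with insert show ?case by simp
qed (simp_all add: Ck_on_const)

text \<open>The product rule pairs the derivative of one factor with the other factor itself. The
  latter is lowered from class \<open>Suc k\<close> to \<open>k\<close>, so that the induction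
  hypothesis, general in \<open>f\<close> and \<open>g\<close>, covers both summands.\<close>

lemma Ck_on_bounded_bilinear:
  assumes "bounded_bilinear B" "openin (Euclidean_space N) S" "Ck_on N k S f" "Ck_on N k S g"
  shows "Ck_on N k S (\<lambda>x. B (f x) (g x))"
  using assms(3,4)
proof (induction k arbitrary: f g)
  case 0
  then show ?case
    using bounded_bilinear.continuous_on[OF assms(1)]
    by (simp add: continuous_map_Euclidean_space_subtopology_iff[OF assms(2)])
next
  case (Suc k)
  have "continuous_on S (\<lambda>x. B (f x) (g x))"
    using Suc.prems assms by (intro bounded_bilinear.continuous_on[OF assms(1)] Ck_on_imp_continuous_on)
  moreover have "\<exists>f'. (\<forall>x\<in>S. ((\<lambda>t. B (f (x(i := t))) (g (x(i := t)))) has_vector_derivative f' x) (at (x i))) \<and>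
             Ck_on N k S f'" if i: "i < N" for i
  proof -
    obtain f' g' where *: "\<And>x. x \<in> S \<Longrightarrow> ((\<lambda>t. f (x(i := t))) has_vector_derivative f' x) (at (x i))"
      "Ck_on N k S f'"
      "\<And>x. x \<in> S \<Longrightarrow> ((\<lambda>t. g (x(i := t))) has_vector_derivative g' x) (at (x i))"
      "Ck_on N k S g'"
      using Ck_on_SucE[OF Suc.prems(1) i] Ck_on_SucE[OF Suc.prems(2) i] by metis
    have "((\<lambda>t. B (f (x(i := t))) (g (x(i := t)))) has_vector_derivative
            B (f x) (g' x) + B (f' x) (g x)) (at (x i))" if "x \<in> S" for x
      using bounded_bilinear.has_vector_derivative[OF assms(1) *(1)[OF that] *(3)[OF that]] by simp
    moreover have "Ck_on N k S (\<lambda>x. B (f x) (g' x) + B (f' x) (g x))"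
      using Ck_on_SucD[OF Suc.prems(1)] Ck_on_SucD[OF Suc.prems(2)] *(2,4)
      by (intro Ck_on_add assms(2) Suc.IH)
    ultimately show ?thesis
      by (intro exI[of _ "\<lambda>x. B (f x) (g' x) + B (f' x) (g x)"]) simp
  qed
  ultimately show ?case
    using assms(2) by (simp add: continuous_map_Euclidean_space_subtopology_iff)
qed

text \<open>Only the first \<open>m\<close> coordinates of the curve move, the others are frozen at \<open>a\<close>.  In the
  step from \<open>m\<close> to \<open>m + 1\<close> the moving coordinates are treated as one variable and the new one as a
  second, so that the two-variable theorem on continuous partial derivatives applies.\<close>

lemma has_vector_derivative_partial_curve:
  fixes f :: "(nat \<Rightarrow> real) \<Rightarrow> 'v::real_normed_vector" and c :: "real \<Rightarrow> nat \<Rightarrow> real"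
  assumes S: "openin (Euclidean_space N) S"
    and f': "\<And>j x. j < N \<Longrightarrow> x \<in> S \<Longrightarrow> ((\<lambda>t. f (x(j := t))) has_vector_derivative f' j x) (at (x j))"
    and cont: "\<And>j. j < N \<Longrightarrow> continuous_on S (f' j)"
    and X: "open X" "a \<in> X" "\<And>j. j < N \<Longrightarrow> continuous_on X (\<lambda>t. c t j)"
    and c': "\<And>j. j < N \<Longrightarrow> ((\<lambda>t. c t j) has_vector_derivative c' j) (at a)"
    and "c a \<in> S" and "m \<le> N"
  shows "((\<lambda>t. f (\<lambda>j. if j < m then c t j else c a j)) has_vector_derivative
           (\<Sum>j<m. c' j *\<^sub>R f' j (c a))) (at a)"
  using \<open>m \<le> N\<close>
proof (induction m)
  case 0
  then show ?case by simp
next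
  case (Suc m)
  \<comment> \<open>\<open>t\<close> moves the first \<open>m\<close> coordinates together,
    \<open>s\<close> moves coordinate \<open>m\<close>, the rest stay at \<open>c a\<close>. The
    curve of the claim is obtained by setting \<open>s = c t m\<close>.\<close>
  define pt where "pt = (\<lambda>(t, s) j. if j < m then c t j else if j = m then s else c a j)"
  obtain O' where O: "open O'" "S = {x. \<forall>i\<ge>N. x i = 0} \<inter> O'"
    using S by (rule openin_Euclidean_space_obtain)
  have zero: "c a j = 0" if "N \<le> j" for j
    using S \<open>c a \<in> S\<close> that openin_Euclidean_space_subset by blast
  have pt_cont: "continuous_on (X \<times> UNIV) pt"
  proof (rule continuous_on_coordinatewise_then_product)
    fix j
    show "continuous_on (X \<times> UNIV) (\<lambda>p. pt p j)"
    proof (cases "j < m")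
      case True
      have "continuous_on X (\<lambda>t. c t j)"
        using X(3)[of j] True Suc.prems by simp
      then have "continuous_on (X \<times> UNIV) (\<lambda>p. c (fst p) j)"
        by (rule continuous_on_compose2[OF _ continuous_on_fst[OF continuous_on_id]]) auto
      then show ?thesis
        using True by (simp add: pt_def case_prod_unfold)
    next
      case False
      then show ?thesis
        by (cases "j = m") (simp_all add: pt_def case_prod_unfold continuous_on_snd)
    qed
  qed
  have pt0: "pt (a, c a m) = c a"
    by (auto simp: pt_def)
  have "open (X \<times> (UNIV :: real set))"
    using X(1) by (simp add: open_Times)
  then have "open ((X \<times> UNIV) \<inter> pt -` O')"
    using pt_cont O(1) by (simp add: continuous_on_open_vimage Int_commute)
  moreover have "(a, c a m) \<in> (X \<times> UNIV) \<inter> pt -` O'"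
    using X(2) pt0 O \<open>c a \<in> S\<close> by simp
  ultimately obtain A B where AB: "open A" "open B" "a \<in> A" "c a m \<in> B"
    "A \<times> B \<subseteq> (X \<times> UNIV) \<inter> pt -` O'"
    by (elim open_prod_elim) auto
  \<comment> \<open>The two-variable theorem asks for a convex second factor, so \<open>B\<close>
    shrinks to a ball.\<close>
  obtain e where e: "e > 0" "ball (c a m) e \<subseteq> B"
    using AB openE by blast
  define Y where "Y = ball (c a m) e"
  have AY: "A \<times> Y \<subseteq> X \<times> UNIV" "\<And>p. p \<in> A \<times> Y \<Longrightarrow> pt p \<in> S"
  proof -
    have AYB: "A \<times> Y \<subseteq> A \<times> B"
      using e(2) by (auto simp: Y_def)
    with AB(5) show "A \<times> Y \<subseteq> X \<times> UNIV" by blast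
    fix p assume "p \<in> A \<times> Y"
    then have "pt p \<in> O'"
      using AB(5) AYB by blast
    moreover have "pt p j = 0" if "N \<le> j" for j
      using zero[OF that] that Suc.prems by (simp add: pt_def case_prod_unfold)
    ultimately show "pt p \<in> S"
      using O(2) by simp
  qed
  \<comment> \<open>The induction hypothesis offers the first partial derivative at \<open>a\<close>
    only. That suffices: existence nearby and continuity are demanded of the second partial
    derivative alone.\<close>
  have 1: "((\<lambda>t. f (pt (t, c a m))) has_derivative
          (\<lambda>h. h *\<^sub>R (\<Sum>j<m. c' j *\<^sub>R f' j (c a)))) (at a within A)"
  proof -
    have "pt (t, c a m) = (\<lambda>j. if j < m then c t j else c a j)" for t
      by (auto simp: pt_def)
    with Suc show ?thesis
      by (simp add: has_vector_derivative_def has_derivative_at_withinI)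
  qed
  have 2: "((\<lambda>s. f (pt (t, s))) has_derivative
      blinfun_apply (blinfun_scaleR_left (f' m (pt (t, s))))) (at s within Y)"
    if "t \<in> A" "s \<in> Y" for t s
  proof -
    have "((\<lambda>s'. f ((pt (t, s))(m := s'))) has_vector_derivative f' m (pt (t, s))) (at (pt (t, s) m))"
      using AY(2) that Suc.prems by (intro f') auto
    moreover have "(pt (t, s))(m := s') = pt (t, s')" for s'
      by (auto simp: pt_def)
    moreover have "pt (t, s) m = s"
      by (simp add: pt_def)
    ultimately show ?thesis
      by (simp add: has_vector_derivative_def has_derivative_at_withinI)
  qed
  have 3: "continuous (at (a, c a m) within A \<times> Y)
      (\<lambda>(t, s). blinfun_scaleR_left (f' m (pt (t, s))))"
  proof -
    have "continuous_on (A \<times> Y) (\<lambda>p. f' m (pt p))"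
      using AY Suc.prems
      by (intro continuous_on_compose2[OF cont continuous_on_subset[OF pt_cont]]) auto
    then have "continuous_on (A \<times> Y) (\<lambda>p. blinfun_scaleR_left (f' m (pt p)))"
      by (rule bounded_linear.continuous_on[OF bounded_linear_blinfun_scaleR_left])
    then show ?thesis
      using AB(3) e(1) by (simp add: continuous_on_eq_continuous_within Y_def case_prod_unfold)
  qed
  have "((\<lambda>(t, s). f (pt (t, s))) has_derivative
      (\<lambda>(h, k). h *\<^sub>R (\<Sum>j<m. c' j *\<^sub>R f' j (c a)) + blinfun_scaleR_left (f' m (pt (a, c a m))) k))
      (at (a, c a m) within A \<times> Y)"
    by (rule has_derivative_partialsI[OF 1 2 3]) (use e in \<open>auto simp: Y_def\<close>)
  then have 4: "((\<lambda>p. f (pt p)) has_derivative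
      (\<lambda>(h, k). h *\<^sub>R (\<Sum>j<m. c' j *\<^sub>R f' j (c a)) + k *\<^sub>R f' m (c a))) (at (a, c a m))"
    using AB e pt0 by (subst (asm) at_within_open) (auto simp: Y_def open_Times case_prod_unfold)
  have 5: "((\<lambda>t. (t, c t m)) has_derivative (\<lambda>h. (h, h *\<^sub>R c' m))) (at a)"
    using c'[of m] Suc.prems
    by (auto simp: has_vector_derivative_def intro!: derivative_eq_intros)
  have "((\<lambda>t. f (pt (t, c t m))) has_derivative
      (\<lambda>h. h *\<^sub>R (\<Sum>j<m. c' j *\<^sub>R f' j (c a)) + (h *\<^sub>R c' m) *\<^sub>R f' m (c a))) (at a)"
    using has_derivative_compose[OF 5] 4 by fastforce
  moreover have "pt (t, c t m) = (\<lambda>j. if j < Suc m then c t j else c a j)" for t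
    by (auto simp: pt_def less_Suc_eq)
  ultimately show ?case
    by (simp add: has_vector_derivative_def scaleR_add_right)
qed

text \<open>The partial derivatives of the composite are sums of products of \<open>u' j\<close>
  with \<open>f' j \<circ> u\<close>. Since \<open>f' j\<close> is again a function of class
  \<open>k\<close> on \<open>S\<close>, the induction on \<open>k\<close> generalizes over
  \<open>f\<close> and keeps \<open>u\<close> fixed.\<close>

lemma Ck_on_compose:
  fixes f :: "(nat \<Rightarrow> real) \<Rightarrow> 'v::real_normed_vector" and u :: "(nat \<Rightarrow> real) \<Rightarrow> nat \<Rightarrow> real"
  assumes S: "openin (Euclidean_space N) S" and W: "openin (Euclidean_space M) W"
    and "u ` W \<subseteq> S"
    and "Ck_on N k S f" "\<And>j. j < N \<Longrightarrow> Ck_on M k W (\<lambda>x. u x j)"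
  shows "Ck_on M k W (\<lambda>x. f (u x))"
  using assms(4,5)
proof (induction k arbitrary: f)
  case k: (0 f)
  \<comment> \<open>Coordinates from \<open>N\<close> on carry no smoothness hypothesis; they vanish
    because \<open>u\<close> lands in a subset of the coordinate space.\<close>
  have "continuous_on W (\<lambda>x. u x j)" for j
  proof (cases "j < N")
    case True
    then show ?thesis using k(2) Ck_on_imp_continuous_on W by blast
  next
    case False
    then have "u x j = 0" if "x \<in> W" for x
      using S assms(3) that openin_Euclidean_space_subset by (metis image_subset_iff not_less)
    then show ?thesis by (simp cong: continuous_on_cong)
  qed
  then have "continuous_on W u"
    by (rule continuous_on_coordinatewise_then_product)
  then have "continuous_on W (\<lambda>x. f (u x))"
    by (rule continuous_on_compose2[OF Ck_on_imp_continuous_on[OF k(1) S] _ assms(3)])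
  with W show ?case
    by (simp add: continuous_map_Euclidean_space_subtopology_iff)
next
  case (Suc k)
  have below: "Ck_on M k W (\<lambda>x. u x j)" if "j < N" for j
    using Suc.prems(2)[OF that] by (rule Ck_on_SucD)
  have "continuous_on W (\<lambda>x. f (u x))"
    using Suc.IH[OF Ck_on_SucD[OF Suc.prems(1)] below] W Ck_on_imp_continuous_on by blast
  moreover have "\<exists>g'. (\<forall>x\<in>W. ((\<lambda>t. f (u (x(i := t)))) has_vector_derivative g' x) (at (x i))) \<and>
             Ck_on M k W g'" if i: "i < M" for i
  proof -
    obtain f' where f': "\<And>j x. j < N \<Longrightarrow> x \<in> S \<Longrightarrow>
        ((\<lambda>t. f (x(j := t))) has_vector_derivative f' j x) (at (x j))"
      "\<And>j. j < N \<Longrightarrow> Ck_on N k S (f' j)"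
    proof -
      have "\<forall>j\<in>{..<N}. \<exists>h. (\<forall>x\<in>S. ((\<lambda>t. f (x(j := t))) has_vector_derivative h x) (at (x j))) \<and>
          Ck_on N k S h"
        using Suc.prems(1) by simp
      from bchoice[OF this] show ?thesis using that by auto
    qed
    have "\<forall>j\<in>{..<N}. \<exists>h. (\<forall>x\<in>W. ((\<lambda>t. u (x(i := t)) j) has_vector_derivative h x) (at (x i))) \<and>
        Ck_on M k W h"
      using Suc.prems(2) i by simp
    from bchoice[OF this] obtain u' where u': "\<And>j x. j < N \<Longrightarrow> x \<in> W \<Longrightarrow>
        ((\<lambda>t. u (x(i := t)) j) has_vector_derivative u' j x) (at (x i))"
      "\<And>j. j < N \<Longrightarrow> Ck_on M k W (u' j)"
      by auto
    have "((\<lambda>t. f (u (x(i := t)))) has_vector_derivative (\<Sum>j<N. u' j x *\<^sub>R f' j (u x))) (at (x i))"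
      if x: "x \<in> W" for x
    proof -
      let ?X = "{t. x(i := t) \<in> W}"
      have X: "open ?X" "x i \<in> ?X"
        using openin_Euclidean_space_line[OF W x i] x by auto
      have "continuous_on ?X (\<lambda>t. u (x(i := t)) j)" if "j < N" for j
        using Ck_on_imp_continuous_on[OF below[OF that] W] continuous_on_fun_upd
        by (rule continuous_on_compose2) auto
      from has_vector_derivative_partial_curve[where c = "\<lambda>t. u (x(i := t))" and X = ?X
          and f = f and f' = f' and c' = "\<lambda>j. u' j x" and m = N and a = "x i",
          OF S f'(1) Ck_on_imp_continuous_on[OF f'(2) S] X this]
      have *: "((\<lambda>t. f (\<lambda>j. if j < N then u (x(i := t)) j else u x j)) has_vector_derivative
          (\<Sum>j<N. u' j x *\<^sub>R f' j (u x))) (at (x i))"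
        using u'(1) x assms(3) by (simp add: image_subset_iff cong: if_cong)
      \<comment> \<open>The curve lemma freezes the coordinates from \<open>N\<close> on. All of
        them are zero while the curve stays in \<open>S\<close>, so freezing changes nothing near
        \<open>x i\<close>.\<close>
      show ?thesis
      proof (rule has_vector_derivative_transform_within_open[OF * X])
        fix t assume "t \<in> ?X"
        then have "u (x(i := t)) \<in> S" "u x \<in> S"
          using assms(3) x by auto
        then have "u x j = u (x(i := t)) j" if "N \<le> j" for j
          using \<open>u (x(i := t)) \<in> S\<close> \<open>u x \<in> S\<close> openin_Euclidean_space_subset[OF S _ that] by metis
        then have "(\<lambda>j. if j < N then u (x(i := t)) j else u x j) = u (x(i := t))"
          by (auto simp: fun_eq_iff not_less)
        then show "f (\<lambda>j. if j < N then u (x(i := t)) j else u x j) = f (u (x(i := t)))"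
          by simp
      qed
    qed
    moreover have "Ck_on M k W (\<lambda>x. \<Sum>j<N. u' j x *\<^sub>R f' j (u x))"
      using below u'(2) f'(2)
      by (intro Ck_on_sum Ck_on_bounded_bilinear[OF bounded_bilinear_scaleR] Suc.IH W) auto
    ultimately show ?thesis
      by (intro exI[of _ "\<lambda>x. \<Sum>j<N. u' j x *\<^sub>R f' j (u x)"]) simp
  qed
  ultimately show ?case
    using W by (simp add: continuous_map_Euclidean_space_subtopology_iff)
qed

section \<open>Smooth maps between manifolds\<close>

text \<open>The part of the definition of a manifold on which the chain rule depends.  Compatibility of
  the charts is only needed for the projections of a product.\<close>

definition charted :: "'a manifold \<Rightarrow> bool"
  where "charted M \<longleftrightarrow>
    (\<forall>(U, \<phi>)\<in>matlas M. openin (mtop M) U \<and> inj_on \<phi> U \<and>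
       (\<forall>W. openin (mtop M) W \<longrightarrow> W \<subseteq> U \<longrightarrow> openin (Euclidean_space (mdim M)) (\<phi> ` W))) \<and>
    \<Union>(fst ` matlas M) = topspace (mtop M)"

text \<open>The restriction to \<Omega> serves the coordinate functions
  \<open>\<psi> (f x) j\<close> of a map, which are meaningful only on the preimage of a chart
  domain. Vector-valued functions are the case \<open>\<Omega> = UNIV\<close>, so one chain rule
  covers both.\<close>

definition smooth_vec_on :: "'a manifold \<Rightarrow> 'a set \<Rightarrow> ('a \<Rightarrow> 'v::real_normed_vector) \<Rightarrow> bool"
  where "smooth_vec_on M \<Omega> f \<longleftrightarrow>
    (\<forall>(U, \<phi>)\<in>matlas M. Cinf_on (mdim M) (\<phi> ` (U \<inter> \<Omega>)) (\<lambda>x. f (inv_into U \<phi> x)))"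

lemma smooth_vec_iff_on_UNIV: "smooth_vec M f \<longleftrightarrow> smooth_vec_on M UNIV f"
  by (simp add: smooth_vec_def smooth_vec_on_def)

lemma smooth_vec_on_subset:
  assumes "smooth_vec_on M \<Omega> f" "\<Omega>' \<subseteq> \<Omega>"
  shows "smooth_vec_on M \<Omega>' f"
  unfolding smooth_vec_on_def Cinf_on_def
proof safe
  fix U \<phi> k assume "(U, \<phi>) \<in> matlas M"
  then have "Ck_on (mdim M) k (\<phi> ` (U \<inter> \<Omega>)) (\<lambda>x. f (inv_into U \<phi> x))"
    using assms(1) unfolding smooth_vec_on_def Cinf_on_def by blast
  then show "Ck_on (mdim M) k (\<phi> ` (U \<inter> \<Omega>')) (\<lambda>x. f (inv_into U \<phi> x))"
    by (rule Ck_on_subset) (use assms(2) in auto)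
qed

lemma smooth_map_iff:
  "smooth_map M N f \<longleftrightarrow> continuous_map (mtop M) (mtop N) f \<and>
     (\<forall>(V, \<psi>)\<in>matlas N. \<forall>j<mdim N. smooth_vec_on M (f -` V) (\<lambda>x. \<psi> (f x) j))"
  unfolding smooth_map_def smooth_vec_on_def case_prod_unfold by blast

lemma chartedD:
  assumes "charted M" "(U, \<phi>) \<in> matlas M"
  shows "openin (mtop M) U" "inj_on \<phi> U"
    "\<And>W. openin (mtop M) W \<Longrightarrow> W \<subseteq> U \<Longrightarrow> openin (Euclidean_space (mdim M)) (\<phi> ` W)"
  using assms unfolding charted_def by blast+

lemma charted_chart_at:
  assumes "charted M" "p \<in> topspace (mtop M)"
  obtains U \<phi> where "(U, \<phi>) \<in> matlas M" "p \<in> U"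
proof -
  have "p \<in> \<Union>(fst ` matlas M)"
    using assms unfolding charted_def by simp
  then obtain c where "c \<in> matlas M" "p \<in> fst c" by auto
  then show ?thesis using that[of "fst c" "snd c"] by simp
qed

lemma smooth_manifold_charted:
  assumes "smooth_manifold M"
  shows "charted M"
proof -
  have "openin (mtop M) U \<and> inj_on \<phi> U \<and>
       (\<forall>W. openin (mtop M) W \<longrightarrow> W \<subseteq> U \<longrightarrow> openin (Euclidean_space (mdim M)) (\<phi> ` W))"
    if "(U, \<phi>) \<in> matlas M" for U \<phi>
  proof (intro conjI allI impI)
    have U: "openin (mtop M) U" "openin (Euclidean_space (mdim M)) (\<phi> ` U)"
      and hom: "homeomorphic_map (subtopology (mtop M) U)
        (subtopology (Euclidean_space (mdim M)) (\<phi> ` U)) \<phi>"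
      using assms that unfolding smooth_manifold_def is_chart_def by auto
    show "openin (mtop M) U" by fact
    have "topspace (subtopology (mtop M) U) = U"
      using openin_subset[OF U(1)] by auto
    then show "inj_on \<phi> U"
      using homeomorphic_imp_injective_map[OF hom] by simp
    fix W assume W: "openin (mtop M) W" "W \<subseteq> U"
    then have "openin (subtopology (mtop M) U) W"
      using U(1) by (simp add: openin_open_subtopology)
    then have "openin (subtopology (Euclidean_space (mdim M)) (\<phi> ` U)) (\<phi> ` W)"
      using homeomorphic_imp_open_map[OF hom] by (simp add: open_map_def)
    then show "openin (Euclidean_space (mdim M)) (\<phi> ` W)"
      using U(2) by (simp add: openin_open_subtopology)
  qed
  moreover have "\<Union>(fst ` matlas M) = topspace (mtop M)"
    using assms by (simp add: smooth_manifold_def)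
  ultimately show ?thesis
    by (auto simp: charted_def)
qed

section \<open>Chain rule on manifolds\<close>

lemma continuous_map_openin_vimage:
  assumes "continuous_map X Y f" "openin X U" "openin Y V"
  shows "openin X (U \<inter> f -` V)"
proof -
  have "U \<inter> f -` V = U \<inter> {x \<in> topspace X. f x \<in> V}"
    using openin_subset[OF assms(2)] by auto
  then show ?thesis
    using openin_Int[OF assms(2) openin_continuous_map_preimage[OF assms(1,3)]] by simp
qed

text \<open>The image of one chart of \<open>M\<close> may spread over many charts of
  \<open>N\<close>. Around each point a single chart \<psi> of \<open>N\<close> suffices: the
  composite factors through the coordinates of \<psi>, and \<open>Ck_on_locally\<close> glues the
  local results.\<close>

lemma smooth_vec_on_compose:
  assumes "charted M" "charted N" "smooth_map M N F"
    and "openin (mtop N) \<Omega>" "smooth_vec_on N \<Omega> h"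
  shows "smooth_vec_on M (F -` \<Omega>) (\<lambda>x. h (F x))"
  unfolding smooth_vec_on_def
proof safe
  fix U \<phi> assume chart: "(U, \<phi>) \<in> matlas M"
  note U = chartedD[OF assms(1) chart]
  have F: "continuous_map (mtop M) (mtop N) F"
    using assms(3) by (simp add: smooth_map_def)
  let ?u = "\<lambda>x. F (inv_into U \<phi> x)"
  have "openin (mtop M) (U \<inter> F -` \<Omega>)"
    by (rule continuous_map_openin_vimage[OF F U(1) assms(4)])
  then have op: "openin (Euclidean_space (mdim M)) (\<phi> ` (U \<inter> F -` \<Omega>))"
    by (rule U(3)) auto
  show "Cinf_on (mdim M) (\<phi> ` (U \<inter> F -` \<Omega>)) (\<lambda>x. h (?u x))"
    unfolding Cinf_on_def
  proof (intro allI Ck_on_locally[OF op])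
    fix k x assume "x \<in> \<phi> ` (U \<inter> F -` \<Omega>)"
    then obtain p where p: "p \<in> U" "F p \<in> \<Omega>" "x = \<phi> p" by auto
    have "F p \<in> topspace (mtop N)"
      using assms(4) p(2) openin_subset by blast
    then obtain V \<psi> where chart': "(V, \<psi>) \<in> matlas N" and "F p \<in> V"
      by (rule charted_chart_at[OF assms(2)])
    note V = chartedD[OF assms(2) chart']
    let ?W = "\<phi> ` (U \<inter> F -` (V \<inter> \<Omega>))"
    have "openin (mtop M) (U \<inter> F -` (V \<inter> \<Omega>))"
      using V(1) assms(4) by (intro continuous_map_openin_vimage[OF F U(1)] openin_Int)
    then have W: "openin (Euclidean_space (mdim M)) ?W"
      by (rule U(3)) auto
    have V\<Omega>: "openin (Euclidean_space (mdim N)) (\<psi> ` (V \<inter> \<Omega>))"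
      using V(1) assms(4) by (intro V(3) openin_Int) auto
    have inv: "?u y \<in> V \<inter> \<Omega>" if "y \<in> ?W" for y
      using that U(2) by auto
    have "Ck_on (mdim N) k (\<psi> ` (V \<inter> \<Omega>)) (\<lambda>y. h (inv_into V \<psi> y))"
      using assms(5) chart' unfolding smooth_vec_on_def Cinf_on_def by blast
    moreover have "Ck_on (mdim M) k ?W (\<lambda>y. \<psi> (?u y) j)" if "j < mdim N" for j
    proof -
      have "Ck_on (mdim M) k (\<phi> ` (U \<inter> F -` V)) (\<lambda>y. \<psi> (?u y) j)"
        using assms(3) chart chart' that unfolding smooth_map_def Cinf_on_def by blast
      then show ?thesis
        by (rule Ck_on_subset) auto
    qed
    ultimately have "Ck_on (mdim M) k ?W (\<lambda>y. h (inv_into V \<psi> (\<psi> (?u y))))"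
      using inv by (intro Ck_on_compose[OF V\<Omega> W, where u = "\<lambda>y. \<psi> (?u y)"
            and f = "\<lambda>z. h (inv_into V \<psi> z)"]) auto
    then have "Ck_on (mdim M) k ?W (\<lambda>y. h (?u y))"
      by (rule Ck_on_cong[OF _ W]) (use inv V(2) in auto)
    moreover have "x \<in> ?W"
      using p \<open>F p \<in> V\<close> by auto
    ultimately show "\<exists>W. openin (Euclidean_space (mdim M)) W \<and> x \<in> W \<and>
        W \<subseteq> \<phi> ` (U \<inter> F -` \<Omega>) \<and> Ck_on (mdim M) k W (\<lambda>x. h (?u x))"
      using W by (intro exI[of _ ?W]) auto
  qed
qed

lemma smooth_map_compose:
  assumes "charted M" "charted N" "charted P" "smooth_map M N F" "smooth_map N P H"
  shows "smooth_map M P (\<lambda>x. H (F x))"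
  unfolding smooth_map_iff
proof safe
  have F: "continuous_map (mtop M) (mtop N) F" and H: "continuous_map (mtop N) (mtop P) H"
    using assms(4,5) by (auto simp: smooth_map_def)
  then show "continuous_map (mtop M) (mtop P) (\<lambda>x. H (F x))"
    using continuous_map_compose[OF F H] by (simp add: o_def)
  fix V \<psi> j assume V: "(V, \<psi>) \<in> matlas P" and j: "j < mdim P"
  have "smooth_vec_on N (H -` V) (\<lambda>x. \<psi> (H x) j)"
    using assms(5) V j unfolding smooth_map_iff by blast
  \<comment> \<open>The set-theoretic preimage of \<open>V\<close> may contain points outside the
    space of \<open>N\<close>. Cutting them off makes it open and loses nothing, since
    \<open>F\<close> maps the chart domains of \<open>M\<close> into that space.\<close>
  then have "smooth_vec_on N (topspace (mtop N) \<inter> H -` V) (\<lambda>x. \<psi> (H x) j)"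
    by (rule smooth_vec_on_subset) auto
  then have "smooth_vec_on M (F -` (topspace (mtop N) \<inter> H -` V)) (\<lambda>x. \<psi> (H (F x)) j)"
    by (intro smooth_vec_on_compose[OF assms(1,2,4)] continuous_map_openin_vimage[OF H]
        chartedD(1)[OF assms(3) V]) auto
  moreover have "U \<inter> F -` (topspace (mtop N) \<inter> H -` V) = U \<inter> (\<lambda>x. H (F x)) -` V"
    if "(U, \<phi>) \<in> matlas M" for U \<phi>
    using openin_subset[OF chartedD(1)[OF assms(1) that]] F
    by (auto simp: continuous_map_def)
  ultimately show "smooth_vec_on M ((\<lambda>x. H (F x)) -` V) (\<lambda>x. \<psi> (H (F x)) j)"
    unfolding smooth_vec_on_def by (auto)
qed

lemma smooth_vec_compose:
  assumes "charted M" "charted N" "smooth_map M N F" "smooth_vec N h"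
  shows "smooth_vec M (\<lambda>x. h (F x))"
  unfolding smooth_vec_def
proof safe
  fix U \<phi> assume chart: "(U, \<phi>) \<in> matlas M"
  have "smooth_vec_on N (topspace (mtop N)) h"
    using assms(4) unfolding smooth_vec_iff_on_UNIV by (rule smooth_vec_on_subset) simp
  then have "smooth_vec_on M (F -` topspace (mtop N)) (\<lambda>x. h (F x))"
    by (intro smooth_vec_on_compose[OF assms(1-3)]) auto
  moreover have "U \<inter> F -` topspace (mtop N) = U"
    using openin_subset[OF chartedD(1)[OF assms(1) chart]] assms(3)
    by (auto simp: continuous_map_def smooth_map_def)
  ultimately show "Cinf_on (mdim M) (\<phi> ` U) (\<lambda>x. h (F (inv_into U \<phi> x)))"
    using chart unfolding smooth_vec_on_def by fastforce
qed

lemma smooth_vec_cong: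
  assumes "charted M" "smooth_vec M f" "\<And>x. x \<in> topspace (mtop M) \<Longrightarrow> f x = g x"
  shows "smooth_vec M g"
  unfolding smooth_vec_def Cinf_on_def
proof safe
  fix U \<phi> k assume chart: "(U, \<phi>) \<in> matlas M"
  note U = chartedD[OF assms(1) chart]
  have "Ck_on (mdim M) k (\<phi> ` U) (\<lambda>x. f (inv_into U \<phi> x))"
    using assms(2) chart unfolding smooth_vec_def Cinf_on_def by blast
  then show "Ck_on (mdim M) k (\<phi> ` U) (\<lambda>x. g (inv_into U \<phi> x))"
    by (rule Ck_on_cong[OF _ U(3)[OF U(1)]])
      (use assms(3) openin_subset[OF U(1)] in \<open>auto simp: inv_into_into subset_iff\<close>)
qed

lemma smooth_map_cong:
  assumes "charted M" "smooth_map M N f" "\<And>x. x \<in> topspace (mtop M) \<Longrightarrow> f x = g x"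
    and "charted N"
  shows "smooth_map M N g"
  unfolding smooth_map_def Cinf_on_def
proof safe
  have f: "continuous_map (mtop M) (mtop N) f"
    using assms(2) by (simp add: smooth_map_def)
  then show "continuous_map (mtop M) (mtop N) g"
    using assms(3) by (rule continuous_map_eq)
  fix U \<phi> V \<psi> j k assume chart: "(U, \<phi>) \<in> matlas M" "(V, \<psi>) \<in> matlas N" and j: "j < mdim N"
  note U = chartedD[OF assms(1) chart(1)]
  have eq: "f p = g p" if "p \<in> U" for p
    using assms(3) openin_subset[OF U(1)] that by blast
  then have sets: "U \<inter> g -` V = U \<inter> f -` V" by auto
  have op: "openin (Euclidean_space (mdim M)) (\<phi> ` (U \<inter> f -` V))"
    by (intro U(3) continuous_map_openin_vimage[OF f U(1)] chartedD(1)[OF assms(4) chart(2)]) auto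
  have "Ck_on (mdim M) k (\<phi> ` (U \<inter> f -` V)) (\<lambda>x. \<psi> (f (inv_into U \<phi> x)) j)"
    using assms(2) chart j unfolding smooth_map_def Cinf_on_def by blast
  then show "Ck_on (mdim M) k (\<phi> ` (U \<inter> g -` V)) (\<lambda>x. \<psi> (g (inv_into U \<phi> x)) j)"
    unfolding sets by (rule Ck_on_cong[OF _ op]) (use eq U(2) in auto)
qed

section \<open>Linear and bilinear operations on smooth vector-valued functions\<close>

lemma smooth_vec_const: "smooth_vec M (\<lambda>x. c)"
  by (auto simp: smooth_vec_def Cinf_on_def Ck_on_const)

lemma smooth_vec_add:
  assumes "charted M" "smooth_vec M f" "smooth_vec M g"
  shows "smooth_vec M (\<lambda>x. f x + g x)"
  unfolding smooth_vec_def Cinf_on_def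
proof safe
  fix U \<phi> k assume chart: "(U, \<phi>) \<in> matlas M"
  note U = chartedD[OF assms(1) chart]
  show "Ck_on (mdim M) k (\<phi> ` U) (\<lambda>x. f (inv_into U \<phi> x) + g (inv_into U \<phi> x))"
    using assms(2,3) chart
    by (intro Ck_on_add U(3)[OF U(1)]) (auto simp: smooth_vec_def Cinf_on_def)
qed

lemma smooth_vec_bounded_bilinear:
  assumes "charted M" "bounded_bilinear B" "smooth_vec M f" "smooth_vec M g"
  shows "smooth_vec M (\<lambda>x. B (f x) (g x))"
  unfolding smooth_vec_def Cinf_on_def
proof safe
  fix U \<phi> k assume chart: "(U, \<phi>) \<in> matlas M"
  note U = chartedD[OF assms(1) chart]
  show "Ck_on (mdim M) k (\<phi> ` U) (\<lambda>x. B (f (inv_into U \<phi> x)) (g (inv_into U \<phi> x)))"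
    using assms(3,4) chart
    by (intro Ck_on_bounded_bilinear[OF assms(2)] U(3)[OF U(1)])
      (auto simp: smooth_vec_def Cinf_on_def)
qed

lemma smooth_vec_bounded_linear:
  assumes "charted M" "bounded_linear L" "smooth_vec M f"
  shows "smooth_vec M (\<lambda>x. L (f x))"
  unfolding smooth_vec_def Cinf_on_def
proof safe
  fix U \<phi> k assume chart: "(U, \<phi>) \<in> matlas M"
  note U = chartedD[OF assms(1) chart]
  show "Ck_on (mdim M) k (\<phi> ` U) (\<lambda>x. L (f (inv_into U \<phi> x)))"
    using assms(3) chart
    by (intro Ck_on_bounded_linear[OF assms(2)] U(3)[OF U(1)])
      (auto simp: smooth_vec_def Cinf_on_def)
qed

lemma smooth_vec_scaleR: "charted M \<Longrightarrow> smooth_vec M f \<Longrightarrow> smooth_vec M (\<lambda>x. c *\<^sub>R f x)"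
  by (rule smooth_vec_bounded_linear[OF _ bounded_linear_scaleR_right])

lemma smooth_vec_diff:
  "charted M \<Longrightarrow> smooth_vec M f \<Longrightarrow> smooth_vec M g \<Longrightarrow> smooth_vec M (\<lambda>x. f x - g x)"
  using smooth_vec_add[of M f "\<lambda>x. (-1) *\<^sub>R g x"] smooth_vec_scaleR[of M g "-1"] by simp

lemma smooth_vec_sum:
  assumes "charted M" "\<And>i. i \<in> I \<Longrightarrow> smooth_vec M (f i)"
  shows "smooth_vec M (\<lambda>x. \<Sum>i\<in>I. f i x)"
  using assms(2)
proof (induction I rule: infinite_finite_induct)
  case (insert i I)
  then have "smooth_vec M (\<lambda>x. f i x + (\<Sum>i\<in>I. f i x))"
    by (intro smooth_vec_add[OF assms(1)]) auto
  with insert show ?case by simp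
qed (simp_all add: smooth_vec_const)

section \<open>Powers of a manifold\<close>

text \<open>A left inverse of the concatenation in \<open>product_chart\<close>: it recovers the
  coordinates of factor \<open>i\<close>, counted from 1. Padding by zeros puts the values into
  \<open>Euclidean_space d\<close>.\<close>

definition block :: "nat \<Rightarrow> nat \<Rightarrow> (nat \<Rightarrow> real) \<Rightarrow> nat \<Rightarrow> real"
  where "block d i x = (\<lambda>j. if j < d then x ((i - 1) * d + j) else 0)"

lemma block_index_less:
  assumes "i \<in> {1..n}" "j < d"
  shows "(i - 1) * d + j < n * (d :: nat)"
proof -
  have "(i - 1) * d + j < (i - 1) * d + d" using assms by simp
  also have "\<dots> = i * d" using assms by (cases i) auto
  also have "\<dots> \<le> n * d" using assms by simp
  finally show ?thesis .
qed

lemma block_index_div: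
  assumes "k < n * (d :: nat)"
  shows "k div d + 1 \<in> {1..n}" "k mod d < d"
  using assms by (auto simp: Suc_le_eq less_mult_imp_div_less intro!: mod_less_divisor gr0I)

lemma block_product_chart:
  assumes "i \<in> {1..n}" "\<And>j. d \<le> j \<Longrightarrow> snd (c i) (g i) j = 0"
  shows "block d i (snd (product_chart d n c) g) = snd (c i) (g i)"
proof
  fix j
  show "block d i (snd (product_chart d n c) g) j = snd (c i) (g i) j"
  proof (cases "j < d")
    case True
    then show ?thesis
      using block_index_less[OF assms(1) True] assms(1)
      by (simp add: block_def product_chart_def)
  next
    case False
    then show ?thesis using assms(2) by (simp add: block_def)
  qed
qed

lemma continuous_map_block:
  assumes "i \<in> {1..n}"
  shows "continuous_map (Euclidean_space (n * d)) (Euclidean_space d) (block d i)"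
  unfolding block_def continuous_map_componentwise_Euclidean_space continuous_map_Euclidean_space_iff
  by (auto intro: continuous_on_subset[OF continuous_on_product_coordinates])

text \<open>Membership in the image is tested factor by factor through the continuous maps
  \<open>block d i\<close>, which presents the image as a finite intersection of open
  preimages.\<close>

lemma product_chart_image:
  assumes "\<And>i. i \<in> {1..n} \<Longrightarrow> openin (Euclidean_space d) (snd (c i) ` B i)"
  shows "snd (product_chart d n c) ` PiE {1..n} B =
    {x \<in> topspace (Euclidean_space (n * d)). \<forall>i\<in>{1..n}. block d i x \<in> snd (c i) ` B i}"
    (is "?f ` _ = ?R")
proof safe
  \<comment> \<open>\<open>block\<close> discards the coordinates from \<open>d\<close> on; points
    of open subsets of \<open>Euclidean_space d\<close> have zeros there.\<close>
  have zero: "snd (c i) p j = 0" if "i \<in> {1..n}" "p \<in> B i" "d \<le> j" for i p j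
    using openin_Euclidean_space_subset[OF assms[OF that(1)] _ that(3)] that(2) by blast
  fix g assume g: "g \<in> PiE {1..n} B"
  show "?f g \<in> topspace (Euclidean_space (n * d))"
    by (simp add: topspace_Euclidean_space product_chart_def)
  fix i assume i: "i \<in> {1..n}"
  then have "block d i (?f g) = snd (c i) (g i)"
    using zero[OF i PiE_mem[OF g i]] by (rule block_product_chart)
  then show "block d i (?f g) \<in> snd (c i) ` B i"
    using g i by auto
next
  fix x assume x: "x \<in> topspace (Euclidean_space (n * d))"
    "\<forall>i\<in>{1..n}. block d i x \<in> snd (c i) ` B i"
  then have "\<forall>i\<in>{1..n}. \<exists>p. p \<in> B i \<and> snd (c i) p = block d i x"
    by force
  from bchoice[OF this] obtain h where
    h: "\<And>i. i \<in> {1..n} \<Longrightarrow> h i \<in> B i \<and> snd (c i) (h i) = block d i x"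
    by blast
  define g where "g = restrict h {1..n}"
  have "?f g k = x k" for k
  proof (cases "k < n * d")
    case True
    have k: "k div d + 1 \<in> {1..n}" "k mod d < d"
      using block_index_div[OF True] by auto
    have "?f g k = block d (k div d + 1) x (k mod d)"
      using True h[OF k(1)] k(1) by (simp add: product_chart_def g_def)
    also have "\<dots> = x k"
      using k(2) by (simp add: block_def)
    finally show ?thesis .
  next
    case False
    then show ?thesis
      using x(1) by (simp add: product_chart_def topspace_Euclidean_space)
  qed
  then have "?f g = x" by auto
  moreover have "g \<in> PiE {1..n} B"
    using h by (auto simp: g_def)
  ultimately show "x \<in> ?f ` PiE {1..n} B" by blast
qed

lemma open_product_chart_image:
  assumes "\<And>i. i \<in> {1..n} \<Longrightarrow> openin (Euclidean_space d) (snd (c i) ` B i)"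
  shows "openin (Euclidean_space (n * d)) (snd (product_chart d n c) ` PiE {1..n} B)"
proof -
  let ?E = "Euclidean_space (n * d)"
  have "openin ?E {x \<in> topspace ?E. block d i x \<in> snd (c i) ` B i}" if "i \<in> {1..n}" for i
    using openin_continuous_map_preimage[OF continuous_map_block[OF that] assms[OF that]] .
  then have "openin ?E (topspace ?E \<inter> (\<Inter>i\<in>{1..n}. {x \<in> topspace ?E. block d i x \<in> snd (c i) ` B i}))"
    by (intro openin_Int_Inter) auto
  also have "topspace ?E \<inter> (\<Inter>i\<in>{1..n}. {x \<in> topspace ?E. block d i x \<in> snd (c i) ` B i}) =
      snd (product_chart d n c) ` PiE {1..n} B"
  proof -
    have "snd (product_chart d n c) ` PiE {1..n} B =
        {x \<in> topspace ?E. \<forall>i\<in>{1..n}. block d i x \<in> snd (c i) ` B i}"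
      by (rule product_chart_image) (rule assms)
    then show ?thesis by blast
  qed
  finally show ?thesis .
qed

lemma power_manifold_simps [simp]:
  "mtop (power_manifold M n) = product_topology (\<lambda>_. mtop M) {1..n}"
  "mdim (power_manifold M n) = n * mdim M"
  "matlas (power_manifold M n) = product_chart (mdim M) n ` PiE {1..n} (\<lambda>_. matlas M)"
  by (simp_all add: power_manifold_def)

lemma charted_power_manifold:
  assumes M: "charted M"
  shows "charted (power_manifold M n)"
proof -
  let ?d = "mdim M" and ?T = "product_topology (\<lambda>_. mtop M) {1..n}"
  have chart: "openin ?T (fst (product_chart ?d n c))"
    "inj_on (snd (product_chart ?d n c)) (fst (product_chart ?d n c))"
    "\<And>W. openin ?T W \<Longrightarrow> W \<subseteq> fst (product_chart ?d n c) \<Longrightarrow>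
       openin (Euclidean_space (n * ?d)) (snd (product_chart ?d n c) ` W)"
    if c: "c \<in> PiE {1..n} (\<lambda>_. matlas M)" for c
  proof -
    let ?f = "snd (product_chart ?d n c)"
    have ci: "openin (mtop M) (fst (c i))" "inj_on (snd (c i)) (fst (c i))"
      "\<And>W. openin (mtop M) W \<Longrightarrow> W \<subseteq> fst (c i) \<Longrightarrow> openin (Euclidean_space ?d) (snd (c i) ` W)"
      if "i \<in> {1..n}" for i
      using chartedD[OF M, of "fst (c i)" "snd (c i)"] PiE_mem[OF c that] by simp_all
    show "openin ?T (fst (product_chart ?d n c))"
      using ci(1) by (simp add: product_chart_def openin_PiE)
    have zero: "snd (c i) p j = 0" if "i \<in> {1..n}" "p \<in> fst (c i)" "?d \<le> j" for i p j
      using openin_Euclidean_space_subset[OF ci(3)[OF that(1) ci(1)[OF that(1)] order_refl] _ that(3)] that(2)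
      by blast
    show "inj_on ?f (fst (product_chart ?d n c))"
    proof (rule inj_onI)
      fix g h assume gh: "g \<in> fst (product_chart ?d n c)" "h \<in> fst (product_chart ?d n c)" "?f g = ?f h"
      then have gh': "g \<in> PiE {1..n} (\<lambda>i. fst (c i))" "h \<in> PiE {1..n} (\<lambda>i. fst (c i))"
        by (auto simp: product_chart_def)
      show "g = h"
      proof (rule PiE_ext[OF gh'])
        fix i assume i: "i \<in> {1..n}"
        have mem: "g i \<in> fst (c i)" "h i \<in> fst (c i)"
          using PiE_mem[OF gh'(1) i] PiE_mem[OF gh'(2) i] .
        have "snd (c i) (g i) = block ?d i (?f g)" "snd (c i) (h i) = block ?d i (?f h)"
          using zero[OF i mem(1)] zero[OF i mem(2)] i by (simp_all add: block_product_chart)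
        then show "g i = h i"
          using gh(3) inj_onD[OF ci(2)[OF i] _ mem] by simp
      qed
    qed
    fix W assume W: "openin ?T W" "W \<subseteq> fst (product_chart ?d n c)"
    show "openin (Euclidean_space (n * ?d)) (?f ` W)"
    \<comment> \<open>An open set of the product is only a union of boxes, so openness of the image
      is verified at each point, with a box inside \<open>W\<close> cut down to the chart
      domain.\<close>
    proof (rule openin_subopen[THEN iffD2], rule ballI)
      fix q assume "q \<in> ?f ` W"
      then obtain p where p: "p \<in> W" "q = ?f p" by blast
      obtain B where B: "\<forall>i\<in>{1..n}. openin (mtop M) (B i)" "p \<in> PiE {1..n} B" "PiE {1..n} B \<subseteq> W"
        using bspec[OF W(1)[unfolded openin_product_topology_alt] p(1)]
        by (elim exE conjE) (rule that)
      let ?B = "\<lambda>i. B i \<inter> fst (c i)"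
      have "openin (Euclidean_space (n * ?d)) (?f ` PiE {1..n} ?B)"
        using B(1) ci(1) by (intro open_product_chart_image ci(3) openin_Int) simp_all
      moreover have "p \<in> PiE {1..n} (\<lambda>i. fst (c i))"
        using W(2) p(1) by (auto simp: product_chart_def)
      then have "p \<in> PiE {1..n} ?B"
        using B(2) by (simp add: PiE_iff)
      moreover have "PiE {1..n} ?B \<subseteq> W"
        using B(3) by (auto simp: PiE_iff subset_iff)
      ultimately show "\<exists>T. openin (Euclidean_space (n * ?d)) T \<and> q \<in> T \<and> T \<subseteq> ?f ` W"
        by (intro exI[of _ "?f ` PiE {1..n} ?B"] conjI image_mono)
          (simp_all add: p(2))
    qed
  qed
  have "p \<in> \<Union> (fst ` matlas (power_manifold M n))" if p: "p \<in> topspace ?T" for p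
  proof -
    have "\<exists>a. a \<in> matlas M \<and> p i \<in> fst a" if "i \<in> {1..n}" for i
    proof -
      have "p i \<in> topspace (mtop M)"
        using p that by auto
      then obtain U \<phi> where "(U, \<phi>) \<in> matlas M" "p i \<in> U"
        by (rule charted_chart_at[OF M])
      then show ?thesis by (intro exI[of _ "(U, \<phi>)"]) simp
    qed
    then have "\<forall>i\<in>{1..n}. \<exists>a. a \<in> matlas M \<and> p i \<in> fst a" by blast
    from bchoice[OF this] obtain c where
      c: "\<And>i. i \<in> {1..n} \<Longrightarrow> c i \<in> matlas M \<and> p i \<in> fst (c i)"
      by blast
    let ?c = "restrict c {1..n}"
    have "?c \<in> PiE {1..n} (\<lambda>_. matlas M)"
      using c by auto
    moreover have "p \<in> fst (product_chart ?d n ?c)"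
      using p c by (auto simp: product_chart_def PiE_iff)
    ultimately show ?thesis
      unfolding power_manifold_simps by blast
  qed
  moreover have "fst (product_chart ?d n c) \<subseteq> topspace ?T" if "c \<in> PiE {1..n} (\<lambda>_. matlas M)" for c
    using openin_subset[OF chart(1)[OF that]] .
  ultimately have "\<Union> (fst ` matlas (power_manifold M n)) = topspace ?T"
    unfolding power_manifold_simps image_image by (intro subset_antisym UN_least) (simp_all add: subset_iff)
  then show ?thesis
    using chart unfolding charted_def case_prod_unfold power_manifold_simps by blast
qed

text \<open>Coordinate \<open>j\<close> of a product chart involves the single factor
  \<open>j div d + 1\<close>, with \<open>d\<close> the dimension of \<open>M\<close>, so each
  coordinate condition is inherited from one \<open>F i\<close>.\<close>

lemma smooth_map_tuple:
  assumes "\<And>i. i \<in> {1..n} \<Longrightarrow> smooth_map P M (F i)"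
  shows "smooth_map P (power_manifold M n) (\<lambda>x. \<lambda>i\<in>{1..n}. F i x)"
  unfolding smooth_map_def Cinf_on_def
proof safe
  let ?F = "\<lambda>x. \<lambda>i\<in>{1..n}. F i x"
  have "continuous_map (mtop P) (mtop M) (F i)" if "i \<in> {1..n}" for i
    using assms[OF that] by (simp add: smooth_map_def)
  then show "continuous_map (mtop P) (mtop (power_manifold M n)) ?F"
    by (auto simp: continuous_map_componentwise)
  fix U \<phi> V \<psi> j k
  assume U: "(U, \<phi>) \<in> matlas P" and V: "(V, \<psi>) \<in> matlas (power_manifold M n)"
    and j: "j < mdim (power_manifold M n)"
  obtain c where c: "c \<in> PiE {1..n} (\<lambda>_. matlas M)" "(V, \<psi>) = product_chart (mdim M) n c"
    using V by auto
  let ?i = "j div mdim M + 1"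
  have i: "?i \<in> {1..n}" "j mod mdim M < mdim M"
    using block_index_div j by auto
  have ci: "(fst (c ?i), snd (c ?i)) \<in> matlas M"
    using PiE_mem[OF c(1) i(1)] by simp
  have "Ck_on (mdim P) k (\<phi> ` (U \<inter> F ?i -` fst (c ?i)))
      (\<lambda>x. snd (c ?i) (F ?i (inv_into U \<phi> x)) (j mod mdim M))"
    using assms[OF i(1)] U ci i(2) unfolding smooth_map_def Cinf_on_def by blast
  then have "Ck_on (mdim P) k (\<phi> ` (U \<inter> ?F -` V))
      (\<lambda>x. snd (c ?i) (F ?i (inv_into U \<phi> x)) (j mod mdim M))"
  proof (rule Ck_on_subset)
    have "F ?i p \<in> fst (c ?i)" if "?F p \<in> V" for p
    proof -
      have "?F p \<in> PiE {1..n} (\<lambda>i. fst (c i))"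
        using that c(2) by (simp add: product_chart_def)
      from PiE_mem[OF this i(1)] show ?thesis
        using i(1) by simp
    qed
    then show "\<phi> ` (U \<inter> ?F -` V) \<subseteq> \<phi> ` (U \<inter> F ?i -` fst (c ?i))" by auto
  qed
  also have "(\<lambda>x. snd (c ?i) (F ?i (inv_into U \<phi> x)) (j mod mdim M)) =
      (\<lambda>x. \<psi> (?F (inv_into U \<phi> x)) j)"
    using c(2) j i(1) by (simp add: product_chart_def)
  finally show "Ck_on (mdim P) k (\<phi> ` (U \<inter> ?F -` V)) (\<lambda>x. \<psi> (?F (inv_into U \<phi> x)) j)" .
qed

text \<open>In charts the projection is \<open>block\<close>, a selection of coordinates, followed
  by the transition map from the \<open>i\<close>-th factor chart to \<psi>.\<close>

lemma smooth_map_projection: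
  assumes M: "smooth_manifold M" and i: "i \<in> {1..n}"
  shows "smooth_map (power_manifold M n) M (\<lambda>g. g i)"
  unfolding smooth_map_def Cinf_on_def
proof safe
  let ?d = "mdim M"
  have cM: "charted M" using smooth_manifold_charted[OF M] .
  have cont: "continuous_map (mtop (power_manifold M n)) (mtop M) (\<lambda>g. g i)"
    unfolding power_manifold_simps by (rule continuous_map_product_projection[OF i])
  then show "continuous_map (mtop (power_manifold M n)) (mtop M) (\<lambda>g. g i)" .
  fix U \<phi> V \<psi> j k
  assume U: "(U, \<phi>) \<in> matlas (power_manifold M n)" and V: "(V, \<psi>) \<in> matlas M" and j: "j < ?d"
  obtain c where c: "c \<in> PiE {1..n} (\<lambda>_. matlas M)" "(U, \<phi>) = product_chart ?d n c"
    using U by auto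
  have U_eq: "U = PiE {1..n} (\<lambda>i. fst (c i))" and \<phi>_eq: "\<phi> = snd (product_chart ?d n c)"
    using c(2) by (simp_all add: product_chart_def)
  note chartU = chartedD[OF charted_power_manifold[OF cM] U]
  have ci: "(fst (c i), snd (c i)) \<in> matlas M"
    using PiE_mem[OF c(1) i] by simp
  note chartC = chartedD[OF cM ci]
  have VO: "openin (mtop M) V"
    by (rule chartedD(1)[OF cM V])
  let ?W = "\<phi> ` (U \<inter> (\<lambda>g. g i) -` V)" and ?S = "snd (c i) ` (fst (c i) \<inter> V)"
  have "openin (mtop (power_manifold M n)) (U \<inter> (\<lambda>g. g i) -` V)"
    by (rule continuous_map_openin_vimage[OF cont chartU(1) VO])
  then have W: "openin (Euclidean_space (n * ?d)) ?W"
    using chartU(3) by simp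
  have S: "openin (Euclidean_space ?d) ?S"
    by (rule chartC(3)[OF openin_Int[OF chartC(1) VO]]) simp
  have bl: "block ?d i (\<phi> g) = snd (c i) (g i)" if "g \<in> U" for g
  proof -
    have "g i \<in> fst (c i)" using PiE_mem[OF that[unfolded U_eq] i] .
    then have "snd (c i) (g i) l = 0" if "?d \<le> l" for l
      using openin_Euclidean_space_subset[OF chartC(3)[OF chartC(1) order_refl] _ that] by blast
    then show ?thesis
      unfolding \<phi>_eq by (rule block_product_chart[OF i])
  qed
  have "block ?d i ` ?W \<subseteq> ?S"
  proof safe
    fix g assume g: "g \<in> U" "g i \<in> V"
    then have "g i \<in> fst (c i) \<inter> V" using PiE_mem[OF g(1)[unfolded U_eq] i] by simp
    with bl[OF g(1)] show "block ?d i (\<phi> g) \<in> ?S" by simp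
  qed
  moreover have "Ck_on ?d k ?S (\<lambda>x. \<psi> (inv_into (fst (c i)) (snd (c i)) x) j)"
  proof -
    have "smooth_compatible ?d (fst (c i), snd (c i)) (V, \<psi>)"
      using M ci V unfolding smooth_manifold_def by blast
    then show ?thesis
      using j unfolding smooth_compatible_def Cinf_on_def prod.case by blast
  qed
  moreover have "Ck_on (n * ?d) k ?W (\<lambda>x. block ?d i x l)" if "l < ?d" for l
    using that Ck_on_coordinate[OF W] by (simp add: block_def)
  ultimately have "Ck_on (n * ?d) k ?W (\<lambda>x. \<psi> (inv_into (fst (c i)) (snd (c i)) (block ?d i x)) j)"
    by (rule Ck_on_compose[OF S W, where u = "block ?d i"])
  then have "Ck_on (n * ?d) k ?W (\<lambda>x. \<psi> (inv_into U \<phi> x i) j)"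
  proof (rule Ck_on_cong[OF _ W], safe)
    fix g assume g: "g \<in> U" "g i \<in> V"
    have "g i \<in> fst (c i)" using PiE_mem[OF g(1)[unfolded U_eq] i] .
    then show "\<psi> (inv_into (fst (c i)) (snd (c i)) (block ?d i (\<phi> g))) j = \<psi> (inv_into U \<phi> (\<phi> g) i) j"
      using bl[OF g(1)] g(1) chartU(2) chartC(2) by simp
  qed
  then show "Ck_on (mdim (power_manifold M n)) k ?W (\<lambda>x. \<psi> (inv_into U \<phi> x i) j)"
    by simp
qed

section \<open>Linear maps on a finite-dimensional space\<close>

text \<open>This is the unit sphere of the l1 norm on coefficient families. Written as functions on
  the whole type, they form a closed subset of a product of compact sets, and Tychonoff's theorem
  applies.\<close>

lemma compact_unit_coefficients:
  assumes "finite A"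
  shows "compact {c :: 'a \<Rightarrow> real. (\<forall>b. b \<notin> A \<longrightarrow> c b = 0) \<and> (\<Sum>b\<in>A. \<bar>c b\<bar>) = 1}"
    (is "compact ?K")
proof -
  let ?P = "PiE UNIV (\<lambda>b. if b \<in> A then {-1..1} else {0 :: real})"
  have "compactin (product_topology (\<lambda>_. euclidean) UNIV) ?P"
    by (subst compactin_PiE) (simp add: compactin_euclidean_iff)
  then have "compact ?P"
    by (simp add: euclidean_product_topology compactin_euclidean_iff)
  moreover have "closed ((\<lambda>c :: 'a \<Rightarrow> real. \<Sum>b\<in>A. \<bar>c b\<bar>) -` {1})"
    by (intro closed_vimage closed_singleton continuous_on_sum continuous_on_rabs
        continuous_on_product_coordinates)
  moreover have "?K = ?P \<inter> (\<lambda>c. \<Sum>b\<in>A. \<bar>c b\<bar>) -` {1}"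
  proof (intro subset_antisym subsetI)
    fix c assume c: "c \<in> ?K"
    have "\<bar>c b\<bar> \<le> 1" if "b \<in> A" for b
      using member_le_sum[of b A "\<lambda>b. \<bar>c b\<bar>"] c that assms by simp
    then show "c \<in> ?P \<inter> (\<lambda>c. \<Sum>b\<in>A. \<bar>c b\<bar>) -` {1}"
      using c by (simp add: PiE_iff abs_le_iff minus_le_iff)
  next
    fix c assume c: "c \<in> ?P \<inter> (\<lambda>c. \<Sum>b\<in>A. \<bar>c b\<bar>) -` {1}"
    then have "c b \<in> (if b \<in> A then {-1..1} else {0})" for b
      by (simp only: Int_iff PiE_iff UNIV_I simp_thms Ball_def)
    then have "c b = 0" if "b \<notin> A" for b
      using that by (metis singletonD)
    then show "c \<in> ?K"
      using c by simp
  qed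
  ultimately show ?thesis
    by (simp add: compact_Int_closed)
qed

text \<open>Independence of a basis \<open>A\<close> keeps the norm of a combination away from zero
  on the unit sphere of coefficients. Hence the norm of a vector controls its coefficients, and
  these control \<open>L\<close> through its values on \<open>A\<close>.\<close>

lemma linear_bounded_finite_span:
  fixes L :: "'v::real_normed_vector \<Rightarrow> 'w::real_normed_vector"
  assumes L: "linear L" and "finite B" and "span B = (UNIV :: 'v set)"
  shows "bounded_linear L"
proof -
  obtain A where A: "A \<subseteq> B" "independent A" "B \<subseteq> span A"
    using maximal_independent_subset[of B] by blast
  have fin: "finite A"
    using A(1) assms(2) by (rule finite_subset)
  have span: "span A = UNIV"
    using span_mono[OF A(3)] assms(3) by (auto simp: span_span)
  define f where "f = (\<lambda>c. \<Sum>b\<in>A. c b *\<^sub>R b)"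
  let ?K = "{c :: 'v \<Rightarrow> real. (\<forall>b. b \<notin> A \<longrightarrow> c b = 0) \<and> (\<Sum>b\<in>A. \<bar>c b\<bar>) = 1}"
  have "\<exists>m>0. \<forall>c\<in>?K. m \<le> norm (f c)"
  proof (cases "?K = {}")
    \<comment> \<open>The sphere is empty exactly when the basis is, that is, for the zero space;
      any positive bound will do.\<close>
    case True
    then show ?thesis by (intro exI[of _ 1] conjI zero_less_one) blast
  next
    case False
    have "continuous_on ?K (\<lambda>c. norm (f c))"
      unfolding f_def
      by (intro continuous_on_norm continuous_on_sum continuous_on_scaleR continuous_on_const
          continuous_on_subset[OF continuous_on_product_coordinates subset_UNIV])
    from continuous_attains_inf[OF compact_unit_coefficients[OF fin] False this]
    obtain c where c: "c \<in> ?K" "\<forall>d\<in>?K. norm (f c) \<le> norm (f d)"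
      by blast
    have "f c \<noteq> 0"
    proof
      assume "f c = 0"
      then have "\<forall>b\<in>A. c b = 0"
        using independentD[OF A(2) fin order_refl, of c] unfolding f_def by blast
      then show False using c(1) by simp
    qed
    with c(2) show ?thesis
      by (intro exI[of _ "norm (f c)"]) simp
  qed
  then obtain m where m: "m > 0" "\<And>c. c \<in> ?K \<Longrightarrow> m \<le> norm (f c)"
    by blast
  define N where "N = (\<Sum>b\<in>A. norm (L b))"
  have "norm (L x) \<le> norm x * (N / m)" for x
  proof -
    have "x \<in> span A" using span by simp
    then obtain c0 where c0: "x = (\<Sum>b\<in>A. c0 b *\<^sub>R b)"
      unfolding span_finite[OF fin] by blast
    define c where "c = (\<lambda>b. if b \<in> A then c0 b else 0)"
    define s where "s = (\<Sum>b\<in>A. \<bar>c b\<bar>)"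
    have x: "x = f c"
      using c0 by (simp add: f_def c_def)
    have s0: "s \<ge> 0"
      by (simp add: s_def sum_nonneg)
    \<comment> \<open>The bound on the sphere extends to all coefficients by dividing them by their
      l1 norm \<open>s\<close>.\<close>
    have lower: "m * s \<le> norm x"
    proof (cases "s = 0")
      case True
      then show ?thesis by simp
    next
      case False
      then have "(\<lambda>b. c b / s) \<in> ?K"
        using s0 by (simp add: c_def s_def flip: sum_divide_distrib)
      then have "m \<le> norm (f (\<lambda>b. c b / s))"
        by (rule m(2))
      also have "f (\<lambda>b. c b / s) = inverse s *\<^sub>R f c"
        by (simp add: f_def scaleR_sum_right divide_inverse mult.commute)
      finally show ?thesis
        using False s0 x by (simp add: field_simps)
    qed
    have "L x = (\<Sum>b\<in>A. c b *\<^sub>R L b)"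
      by (simp add: x f_def linear_sum[OF L] linear_scale[OF L])
    then have "norm (L x) \<le> (\<Sum>b\<in>A. \<bar>c b\<bar> * norm (L b))"
      by (metis (no_types, lifting) norm_scaleR norm_sum sum.cong)
    also have "\<dots> \<le> (\<Sum>b\<in>A. \<bar>c b\<bar> * N)"
      unfolding N_def by (intro sum_mono mult_left_mono member_le_sum fin) auto
    also have "\<dots> = s * N"
      by (simp add: s_def sum_distrib_right)
    also have "\<dots> \<le> norm x / m * N"
    proof (rule mult_right_mono)
      show "s \<le> norm x / m"
        using lower m(1) by (simp add: field_simps)
      show "0 \<le> N"
        by (simp add: N_def sum_nonneg)
    qed
    finally show ?thesis
      by simp
  qed
  then show ?thesis
    using L by (intro bounded_linear_intro[of L "N / m"]) (simp_all add: linear_add linear_scale)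
qed

section \<open>The group cochain complex\<close>

text \<open>The term at \<open>(j, i)\<close> with \<open>i < j\<close> is the negative of the one
  at \<open>(i, j - 1)\<close>, and this correspondence is a bijection onto the remaining index
  pairs. In the application \<open>h j i\<close> is a coface applied to a coface.\<close>

lemma alternating_double_sum_zero:
  fixes h :: "nat \<Rightarrow> nat \<Rightarrow> 'v::real_vector"
  assumes "\<And>i j. i < j \<Longrightarrow> j \<le> n + 1 \<Longrightarrow> h j i = h i (j - 1)"
  shows "(\<Sum>j\<le>n + 1. (-1) ^ j *\<^sub>R (\<Sum>i\<le>n. (-1) ^ i *\<^sub>R h j i)) = 0"
proof -
  let ?f = "\<lambda>(j, i). (-1) ^ (j + i) *\<^sub>R h j i"
  let ?S = "{..n + 1} \<times> {..n}"
  let ?A = "{(j, i). i < j \<and> j \<le> n + 1}" and ?B = "{(j, i). j \<le> i \<and> i \<le> n}"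
  have "(\<Sum>j\<le>n + 1. (-1) ^ j *\<^sub>R (\<Sum>i\<le>n. (-1) ^ i *\<^sub>R h j i)) = (\<Sum>p\<in>?S. ?f p)"
    by (simp add: scaleR_sum_right sum.cartesian_product power_add case_prod_unfold)
  also have "?S = ?A \<union> ?B" by auto
  also have "sum ?f (?A \<union> ?B) = sum ?f ?A + sum ?f ?B"
  proof (rule sum.union_disjoint)
    show "finite ?A" "finite ?B"
      by (rule finite_subset[of _ ?S]; force)+
  qed auto
  also have "sum ?f ?A = (\<Sum>p\<in>?B. - ?f p)"
  proof (rule sum.reindex_bij_witness[where i = "\<lambda>(j, i). (i + 1, j)" and j = "\<lambda>(j, i). (i, j - 1)"])
    fix p assume "p \<in> ?A"
    then obtain j i where p: "p = (j, i)" "i < j" "j \<le> n + 1" by auto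
    then obtain k where k: "j = Suc k" by (cases j) auto
    show "(case case p of (j, i) \<Rightarrow> (i, j - 1) of (j, i) \<Rightarrow> (i + 1, j)) = p"
      using p by simp
    show "(case p of (j, i) \<Rightarrow> (i, j - 1)) \<in> ?B"
      using p by (simp add: k)
    show "- ?f (case p of (j, i) \<Rightarrow> (i, j - 1)) = ?f p"
      using p assms[OF p(2,3)] by (simp add: k add.commute)
  qed auto
  finally show ?thesis
    by (simp add: sum_negf)
qed

text \<open>The pattern behind normalization: if entry \<open>k + 1\<close> of a tuple is the unit,
  cofaces \<open>k\<close> and \<open>Suc k\<close> agree and cancel, while all others
  vanish.\<close>

lemma sum_minus_one_power_cancel:
  fixes f :: "nat \<Rightarrow> 'v::real_vector"
  assumes "k \<le> n" "f k = f (Suc k)" "\<And>i. i \<noteq> k \<Longrightarrow> i \<noteq> Suc k \<Longrightarrow> i \<le> Suc n \<Longrightarrow> f i = 0"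
  shows "(\<Sum>i\<le>Suc n. (-1) ^ i *\<^sub>R f i) = 0"
proof -
  have "(\<Sum>i\<le>Suc n. (-1) ^ i *\<^sub>R f i) = (\<Sum>i\<in>{k, Suc k}. (-1) ^ i *\<^sub>R f i)"
    using assms(1,3) by (intro sum.mono_neutral_right) auto
  then show ?thesis
    using assms(2) by simp
qed

text \<open>The indices \<open>i = 0\<close> and \<open>i = n + 1\<close> drop the first and the last entry: in the uniform
  formula one of the comparisons with \<open>i\<close> is then never met.\<close>

definition face :: "('g, 'm) monoid_scheme \<Rightarrow> nat \<Rightarrow> nat \<Rightarrow> (nat \<Rightarrow> 'g) \<Rightarrow> nat \<Rightarrow> 'g"
  where "face G n i g = (\<lambda>j\<in>{1..n}. if j < i then g j
     else if j = i then g i \<otimes>\<^bsub>G\<^esub> g (i + 1) else g (j + 1))"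

lemma face_apply:
  assumes "k \<in> {1..n}"
  shows "k < i \<Longrightarrow> face G n i g k = g k"
    and "face G n k g k = g k \<otimes>\<^bsub>G\<^esub> g (Suc k)"
    and "i < k \<Longrightarrow> face G n i g k = g (Suc k)"
  using assms by (auto simp: face_def)

text \<open>The cosimplicial structure maps of group cohomology. With the coboundary as their
  alternating sum, the vanishing of its square becomes a matter of exchanging two indices.\<close>

definition coface :: "('g, 'm) monoid_scheme \<Rightarrow> ('g \<Rightarrow> ('v::real_normed_vector \<Rightarrow>\<^sub>L 'v)) \<Rightarrow> nat \<Rightarrow> nat
      \<Rightarrow> ((nat \<Rightarrow> 'g) \<Rightarrow> 'v) \<Rightarrow> (nat \<Rightarrow> 'g) \<Rightarrow> 'v"
  where "coface G \<Theta> n i \<alpha> g =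
    (if i = 0 then blinfun_apply (\<Theta> (g 1)) (\<alpha> (face G n 0 g)) else \<alpha> (face G n i g))"

lemma coboundary_eq_sum_coface:
  assumes "g \<in> tuples G (n + 1)"
  shows "coboundary G \<Theta> n \<alpha> g = (\<Sum>i\<le>n + 1. (-1) ^ i *\<^sub>R coface G \<Theta> n i \<alpha> g)"
proof -
  have "(\<lambda>j\<in>{1..n}. g (j + 1)) = face G n 0 g" "(\<lambda>j\<in>{1..n}. g j) = face G n (n + 1) g"
    by (auto simp: face_def fun_eq_iff)
  moreover have "(\<Sum>i\<le>n + 1. (-1) ^ i *\<^sub>R coface G \<Theta> n i \<alpha> g) =
      coface G \<Theta> n 0 \<alpha> g + (\<Sum>i=1..n. (-1) ^ i *\<^sub>R coface G \<Theta> n i \<alpha> g) +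
      (-1) ^ (n + 1) *\<^sub>R coface G \<Theta> n (n + 1) \<alpha> g"
    by (simp add: atMost_atLeast0 sum.atLeast_Suc_atMost)
  ultimately show ?thesis
    using assms by (simp add: coboundary_def coface_def face_def)
qed

lemma tuplesD: "g \<in> tuples G n \<Longrightarrow> i \<in> {1..n} \<Longrightarrow> g i \<in> carrier G"
  by (auto simp: tuples_def)

context monoid
begin

lemma face_in_tuples:
  assumes "g \<in> tuples G (n + 1)" "i \<le> n + 1"
  shows "face G n i g \<in> tuples G n"
  using tuplesD[OF assms(1)] assms(2) by (auto simp: face_def tuples_def)

text \<open>This is the simplicial identity. Associativity enters in one situation only,
  \<open>j = i + 1\<close> at position \<open>i\<close>, where three consecutive entries are
  multiplied.\<close>

lemma face_face:
  assumes g: "g \<in> tuples G (n + 2)" and "i < j" "j \<le> n + 2"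
  shows "face G n i (face G (n + 1) j g) = face G n (j - 1) (face G (n + 1) i g)"
proof
  fix k
  show "face G n i (face G (n + 1) j g) k = face G n (j - 1) (face G (n + 1) i g) k"
  proof (cases "k \<in> {1..n}")
    case False
    then show ?thesis by (simp only: face_def restrict_apply if_False)
  next
    case k: True
    have mem: "g k \<in> carrier G" "g (Suc k) \<in> carrier G" "g (Suc (Suc k)) \<in> carrier G"
      using k by (auto intro!: tuplesD[OF g])
    \<comment> \<open>Writing \<open>j = Suc l\<close> removes the truncated subtraction; position
      \<open>k\<close> is then compared with both \<open>i\<close> and \<open>l\<close>.\<close>
    obtain l where l: "j = Suc l" "i \<le> l"
      using assms(2) by (cases j) auto
    consider "k < i" | "k = i" "k = l" | "k = i" "k < l" | "i < k" "k < l" | "i < k" "k = l" | "l < k"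
      using l(2) by linarith
    then show ?thesis
      using l mem k by cases (simp_all add: face_apply m_assoc)
  qed
qed

end

text \<open>Instantiated for \<Theta> and for \<open>twisted_rep G D \<Theta>\<close>, so that the
  two coboundary operators share one theory.\<close>

locale smooth_representation = lie_group G M
  for G :: "('g, 'm) monoid_scheme" (structure) and M :: "'g manifold" +
  fixes \<Theta> :: "'g \<Rightarrow> ('v::real_normed_vector \<Rightarrow>\<^sub>L 'v)"
  assumes rep_mult: "\<And>g h. g \<in> carrier G \<Longrightarrow> h \<in> carrier G \<Longrightarrow> \<Theta> (g \<otimes> h) = \<Theta> g o\<^sub>L \<Theta> h"
    and rep_one: "\<Theta> \<one> = id_blinfun"
    and rep_smooth: "smooth_vec M \<Theta>"
begin

text \<open>For \<open>i > 0\<close> this is the simplicial identity for faces. At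
  \<open>i = 0\<close>, \<open>j = 1\<close> one side acts by the product of the first two entries
  and the other by one after the other, which multiplicativity of \<Theta> identifies. For
  \<open>i = 0\<close> and larger \<open>j\<close> face \<open>j\<close> leaves the first entry
  alone.\<close>

lemma coface_coface:
  assumes g: "g \<in> tuples G (n + 2)" and ij: "i < j" "j \<le> n + 2"
  shows "coface G \<Theta> (n + 1) j (coface G \<Theta> n i \<alpha>) g = coface G \<Theta> (n + 1) i (coface G \<Theta> n (j - 1) \<alpha>) g"
proof (cases "i = 0")
  case False
  then show ?thesis
    using face_face[OF g ij] ij by (simp add: coface_def)
next
  case True
  have mem: "g 1 \<in> carrier G" "g 2 \<in> carrier G"
    by (auto intro!: tuplesD[OF g])
  show ?thesis
  proof (cases "j = 1")
    case j: True
    then show ?thesis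
      using face_face[OF g ij] True rep_mult[OF mem]
      by (simp add: coface_def) (simp add: face_def numeral_2_eq_2)
  next
    case False
    then have "j > 1" "face G (n + 1) j g 1 = g 1"
      using ij by (auto simp: face_def)
    then show ?thesis
      using face_face[OF g ij] True by (simp add: coface_def)
  qed
qed

lemma coface_sum:
  assumes "finite I"
  shows "coface G \<Theta> n j (\<lambda>g. \<Sum>i\<in>I. c i *\<^sub>R \<alpha> i g) g = (\<Sum>i\<in>I. c i *\<^sub>R coface G \<Theta> n j (\<alpha> i) g)"
  by (simp add: coface_def blinfun.sum_right blinfun.scaleR_right)

lemma coface_cong:
  assumes "g \<in> tuples G (n + 1)" "i \<le> n + 1" "\<And>h. h \<in> tuples G n \<Longrightarrow> \<alpha> h = \<beta> h"
  shows "coface G \<Theta> n i \<alpha> g = coface G \<Theta> n i \<beta> g"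
  using assms(3) face_in_tuples[OF assms(1)] assms(2) by (simp add: coface_def)

lemma coboundary_coboundary: "coboundary G \<Theta> (n + 1) (coboundary G \<Theta> n \<alpha>) = 0"
proof
  fix g
  show "coboundary G \<Theta> (n + 1) (coboundary G \<Theta> n \<alpha>) g = 0 g"
  proof (cases "g \<in> tuples G (n + 2)")
    case False
    then show ?thesis by (simp add: coboundary_def)
  next
    case True
    then have g: "g \<in> tuples G (n + 1 + 1)" by simp
    have "coboundary G \<Theta> (n + 1) (coboundary G \<Theta> n \<alpha>) g =
        (\<Sum>j\<le>n + 1 + 1. (-1) ^ j *\<^sub>R coface G \<Theta> (n + 1) j (coboundary G \<Theta> n \<alpha>) g)"
      by (rule coboundary_eq_sum_coface[OF g])
    also have "\<dots> = (\<Sum>j\<le>n + 1 + 1. (-1) ^ j *\<^sub>R (\<Sum>i\<le>n + 1. (-1) ^ i *\<^sub>R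
        coface G \<Theta> (n + 1) j (coface G \<Theta> n i \<alpha>) g))"
    proof (intro sum.cong refl arg_cong[where f = "scaleR _"])
      fix j assume "j \<in> {..n + 1 + 1}"
      \<comment> \<open>The coboundary is cut off to 0 outside the tuples and equals the sum of
        cofaces only on them. The faces of \<open>g\<close> are tuples again, so it may be replaced
        under the outer coface.\<close>
      then have "coface G \<Theta> (n + 1) j (coboundary G \<Theta> n \<alpha>) g =
          coface G \<Theta> (n + 1) j (\<lambda>h. \<Sum>i\<le>n + 1. (-1) ^ i *\<^sub>R coface G \<Theta> n i \<alpha> h) g"
        by (intro coface_cong[OF g] coboundary_eq_sum_coface) auto
      then show "coface G \<Theta> (n + 1) j (coboundary G \<Theta> n \<alpha>) g =
          (\<Sum>i\<le>n + 1. (-1) ^ i *\<^sub>R coface G \<Theta> (n + 1) j (coface G \<Theta> n i \<alpha>) g)"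
        by (simp only: coface_sum[OF finite_atMost])
    qed
    also have "\<dots> = 0"
      by (rule alternating_double_sum_zero) (use coface_coface[OF True] in auto)
    finally show ?thesis by simp
  qed
qed

lemma coboundary_add: "coboundary G \<Theta> n (\<alpha> + \<beta>) = coboundary G \<Theta> n \<alpha> + coboundary G \<Theta> n \<beta>"
proof
  fix g
  show "coboundary G \<Theta> n (\<alpha> + \<beta>) g = (coboundary G \<Theta> n \<alpha> + coboundary G \<Theta> n \<beta>) g"
  proof (cases "g \<in> tuples G (n + 1)")
    case True
    have "coface G \<Theta> n i (\<alpha> + \<beta>) g = coface G \<Theta> n i \<alpha> g + coface G \<Theta> n i \<beta> g" for i
      by (simp add: coface_def blinfun.add_right)
    then show ?thesis
      using True by (simp add: coboundary_eq_sum_coface[OF True] scaleR_add_right sum.distrib)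
  qed (simp add: coboundary_def)
qed

lemma coboundary_scaleR: "coboundary G \<Theta> n (c *\<^sub>R \<alpha>) = c *\<^sub>R coboundary G \<Theta> n \<alpha>"
proof
  fix g
  show "coboundary G \<Theta> n (c *\<^sub>R \<alpha>) g = (c *\<^sub>R coboundary G \<Theta> n \<alpha>) g"
  proof (cases "g \<in> tuples G (n + 1)")
    case True
    have "coface G \<Theta> n i (c *\<^sub>R \<alpha>) g = c *\<^sub>R coface G \<Theta> n i \<alpha> g" for i
      by (simp add: coface_def blinfun.scaleR_right scaleR_fun_def)
    then show ?thesis
      by (simp add: coboundary_eq_sum_coface[OF True] scaleR_fun_def scaleR_sum_right mult.commute
          scaleR_diff_right)
  qed (simp add: coboundary_def scaleR_fun_def)
qed

end

section \<open>Smooth face maps and the space of normalized cochains\<close>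

lemma (in lie_group) charted_manifold: "charted M"
  using smooth_manifold_charted[OF manifold] .

lemma (in lie_group) charted_power: "charted (power_manifold M n)"
  by (rule charted_power_manifold[OF charted_manifold])

lemma (in lie_group) topspace_power: "topspace (mtop (power_manifold M n)) = tuples G n"
  by (simp add: tuples_def topspace_eq)

lemma (in lie_group) smooth_mult_compose:
  assumes P: "charted P" and "smooth_map P M f" "smooth_map P M h"
  shows "smooth_map P M (\<lambda>x. f x \<otimes> h x)"
proof -
  let ?F = "\<lambda>x. \<lambda>i\<in>{1..2 :: nat}. (if i = 1 then f else h) x"
  have "smooth_map P (power_manifold M 2) ?F"
    by (rule smooth_map_tuple) (use assms in auto)
  from smooth_map_compose[OF P charted_power charted_manifold this smooth_mult]
  show ?thesis by simp
qed

lemma (in lie_group) smooth_coordinate: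
  "i \<in> {1..n} \<Longrightarrow> smooth_map (power_manifold M n) M (\<lambda>g. g i)"
  by (rule smooth_map_projection[OF manifold])

lemma (in lie_group) smooth_face:
  assumes "i \<le> n + 1"
  shows "smooth_map (power_manifold M (n + 1)) (power_manifold M n) (face G n i)"
proof -
  have "smooth_map (power_manifold M (n + 1)) M (\<lambda>g. if j < i then g j
     else if j = i then g i \<otimes> g (i + 1) else g (j + 1))" if j: "j \<in> {1..n}" for j
  proof -
    have "smooth_map (power_manifold M (n + 1)) M (\<lambda>g. g j)"
      "smooth_map (power_manifold M (n + 1)) M (\<lambda>g. g (j + 1))"
      using j by (intro smooth_coordinate; simp)+
    moreover from this have "smooth_map (power_manifold M (n + 1)) M (\<lambda>g. g j \<otimes> g (j + 1))"
      by (intro smooth_mult_compose charted_power)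
    ultimately show ?thesis
      by (cases j i rule: linorder_cases) auto
  qed
  from smooth_map_tuple[OF this] show ?thesis
    by (simp only: face_def[abs_def])
qed

lemma cochainsD:
  assumes "\<alpha> \<in> cochains G M n"
  shows "smooth_vec (power_manifold M n) \<alpha>"
    and "\<And>g i. g \<in> tuples G n \<Longrightarrow> i \<in> {1..n} \<Longrightarrow> g i = \<one>\<^bsub>G\<^esub> \<Longrightarrow> \<alpha> g = 0"
    and "\<And>g. g \<notin> tuples G n \<Longrightarrow> \<alpha> g = 0"
  using assms by (auto simp: cochains_def)

lemma (in lie_group) subspace_cochains:
  "subspace (cochains G M n :: ((nat \<Rightarrow> 'g) \<Rightarrow> 'v::real_normed_vector) set)"
proof (rule subspaceI)
  show "0 \<in> cochains G M n"
    using smooth_vec_const[of "power_manifold M n" 0] by (simp add: cochains_def zero_fun_def)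
  fix \<alpha> \<beta> :: "(nat \<Rightarrow> 'g) \<Rightarrow> 'v" and c :: real
  assume \<alpha>: "\<alpha> \<in> cochains G M n"
  then show "c *\<^sub>R \<alpha> \<in> cochains G M n"
    using smooth_vec_scaleR[OF charted_power cochainsD(1)[OF \<alpha>], of c]
    by (auto simp: cochains_def scaleR_fun_def)
  assume \<beta>: "\<beta> \<in> cochains G M n"
  then show "\<alpha> + \<beta> \<in> cochains G M n"
    using \<alpha> smooth_vec_add[OF charted_power cochainsD(1)[OF \<alpha>] cochainsD(1)[OF \<beta>]]
    by (auto simp: cochains_def plus_fun_def)
qed

lemma (in smooth_representation) coboundary_in_cochains:
  assumes \<alpha>: "\<alpha> \<in> cochains G M n"
  shows "coboundary G \<Theta> n \<alpha> \<in> cochains G M (n + 1)"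
  unfolding cochains_def
proof (intro CollectI conjI ballI allI impI)
  let ?P = "power_manifold M (n + 1)"
  have "smooth_vec ?P (coface G \<Theta> n i \<alpha>)" if "i \<le> n + 1" for i
  proof -
    have *: "smooth_vec ?P (\<lambda>g. \<alpha> (face G n i g))"
      by (rule smooth_vec_compose[OF charted_power charted_power smooth_face[OF that] cochainsD(1)[OF \<alpha>]])
    have **: "smooth_vec ?P (\<lambda>g. \<Theta> (g 1))"
      by (rule smooth_vec_compose[OF charted_power charted_manifold smooth_coordinate rep_smooth]) simp
    show ?thesis
    proof (cases "i = 0")
      case True
      with smooth_vec_bounded_bilinear[OF charted_power bounded_bilinear_blinfun_apply ** *]
      show ?thesis by (simp add: coface_def[abs_def])
    next
      case False
      with * show ?thesis by (simp add: coface_def[abs_def])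
    qed
  qed
  then have "smooth_vec ?P (\<lambda>g. \<Sum>i\<le>n + 1. (-1) ^ i *\<^sub>R coface G \<Theta> n i \<alpha> g)"
    by (intro smooth_vec_sum smooth_vec_scaleR charted_power) auto
  then show "smooth_vec ?P (coboundary G \<Theta> n \<alpha>)"
    by (rule smooth_vec_cong[OF charted_power]) (simp only: topspace_power coboundary_eq_sum_coface)
  show "coboundary G \<Theta> n \<alpha> g = 0" if "g \<notin> tuples G (n + 1)" for g
    using that by (simp add: coboundary_def)
  fix g assume g: "g \<in> tuples G (n + 1)" and "\<exists>k\<in>{1..n + 1}. g k = \<one>"
  \<comment> \<open>With the unit at position \<open>k + 1\<close>, the faces that merge it with a
    neighbour, or delete it at an end, are exactly those numbered \<open>k\<close> and
    \<open>k + 1\<close>.\<close>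
  then obtain k where k: "k \<le> n" "g (Suc k) = \<one>"
    by (auto simp: Suc_le_eq elim!: less_natE)
  have "(\<Sum>i\<le>Suc n. (-1) ^ i *\<^sub>R coface G \<Theta> n i \<alpha> g) = 0"
  proof (rule sum_minus_one_power_cancel[OF k(1)])
    have "face G n k g = face G n (Suc k) g"
    proof
      fix l
      show "face G n k g l = face G n (Suc k) g l"
      proof (cases "l \<in> {1..n}")
        case False
        then show ?thesis by (simp only: face_def restrict_apply if_False)
      next
        case l: True
        have mem: "g l \<in> carrier G" "g (Suc l) \<in> carrier G"
          using l by (auto intro!: tuplesD[OF g])
        consider "l < k" | "l = k" | "l = Suc k" | "Suc k < l" by linarith
        then show ?thesis
          using k l mem by cases (simp_all add: face_apply)
      qed
    qed
    \<comment> \<open>For \<open>k = 0\<close> coface 0 carries the factor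
      \<open>\<Theta> (g 1)\<close>, which is the identity map as \<open>g 1\<close> is the
      unit.\<close>
    then show "coface G \<Theta> n k \<alpha> g = coface G \<Theta> n (Suc k) \<alpha> g"
      using k by (cases "k = 0") (simp_all add: coface_def rep_one)
    fix i assume i: "i \<noteq> k" "i \<noteq> Suc k" "i \<le> Suc n"
    \<comment> \<open>The position of the unit after face \<open>i\<close>: it moves one step to the
      left when the face acts before it.\<close>
    define l where "l = (if i < k then k else Suc k)"
    have l: "l \<in> {1..n}"
      using i k(1) by (auto simp: l_def)
    moreover have "face G n i g l = \<one>"
      using i k l by (auto simp: l_def face_apply)
    ultimately have "\<alpha> (face G n i g) = 0"
      using i(3) by (intro cochainsD(2)[OF \<alpha>] face_in_tuples[OF g]) auto
    then show "coface G \<Theta> n i \<alpha> g = 0"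
      by (auto simp: coface_def)
  qed
  then show "coboundary G \<Theta> n \<alpha> g = 0"
    by (simp only: coboundary_eq_sum_coface[OF g] Suc_eq_plus1)
qed

section \<open>The difference cochain complex\<close>

text \<open>The \<iota> of the overview, the homotopy from which K' is built.\<close>

definition graph_pullback :: "('g, 'm) monoid_scheme \<Rightarrow> ('g \<Rightarrow> 'g)
      \<Rightarrow> ((nat \<Rightarrow> 'g) \<Rightarrow> 'v::real_normed_vector) \<Rightarrow> (nat \<Rightarrow> 'g) \<Rightarrow> 'v"
  where "graph_pullback G D \<alpha> g = (if g \<in> tuples G 1 then \<alpha> (tup [D (g 1), g 1]) else 0)"

definition twist :: "('g, 'm) monoid_scheme \<Rightarrow> ('g \<Rightarrow> 'g) \<Rightarrow> nat \<Rightarrow> (nat \<Rightarrow> 'g) \<Rightarrow> nat \<Rightarrow> 'g"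
  where "twist G D n g = (\<lambda>i\<in>{1..n}. D (g i) \<otimes>\<^bsub>G\<^esub> g i)"

text \<open>The E of the overview. Keeping the sign \<open>(-1) ^ n\<close> apart lets it commute
  with the coboundaries exactly.\<close>

definition twist_defect :: "('g, 'm) monoid_scheme \<Rightarrow> ('g \<Rightarrow> 'g)
      \<Rightarrow> ('v::real_normed_vector \<Rightarrow> 'v) \<Rightarrow> nat \<Rightarrow> ((nat \<Rightarrow> 'g) \<Rightarrow> 'v) \<Rightarrow> (nat \<Rightarrow> 'g) \<Rightarrow> 'v"
  where "twist_defect G D T n \<alpha> g =
    (if g \<in> tuples G n then \<alpha> (twist G D n g) - T (\<alpha> g) - \<alpha> g else 0)"

lemma K_hat_eq: "K_hat G D T n \<alpha> = (-1) ^ n *\<^sub>R twist_defect G D T n \<alpha>"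
  by (auto simp: K_hat_def twist_defect_def twist_def scaleR_fun_def fun_eq_iff)

lemma tup_pair: "tup [a, b] = (\<lambda>i\<in>{1..2}. if i = 1 then a else b)"
  by (auto simp: tup_def fun_eq_iff nth_Cons split: nat.split)

lemma graph_pullback_add: "graph_pullback G D (\<alpha> + \<beta>) = graph_pullback G D \<alpha> + graph_pullback G D \<beta>"
  by (auto simp: graph_pullback_def fun_eq_iff)

lemma graph_pullback_scaleR: "graph_pullback G D (c *\<^sub>R \<alpha>) = c *\<^sub>R graph_pullback G D \<alpha>"
  by (auto simp: graph_pullback_def fun_eq_iff scaleR_fun_def)

lemma twist_defect_add:
  "linear T \<Longrightarrow> twist_defect G D T n (\<alpha> + \<beta>) = twist_defect G D T n \<alpha> + twist_defect G D T n \<beta>"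
  by (auto simp: twist_defect_def fun_eq_iff linear_add)

lemma twist_defect_scaleR:
  "linear T \<Longrightarrow> twist_defect G D T n (c *\<^sub>R \<alpha>) = c *\<^sub>R twist_defect G D T n \<alpha>"
  by (auto simp: twist_defect_def fun_eq_iff scaleR_fun_def linear_scale scaleR_diff_right)

section \<open>The endomorphism \<open>D g \<otimes> g\<close> and its action on tuples and
  cochains\<close>

context difference_lie_group
begin

text \<open>Closure is contained in the continuity of \<open>D\<close>, the underlying space of
  \<open>M\<close> being the carrier.\<close>

lemma D_closed: "g \<in> carrier G \<Longrightarrow> D g \<in> carrier G"
  using smooth_D topspace_eq by (auto simp: smooth_map_def continuous_map_def)

text \<open>The difference identity makes \<open>D \<one>\<close> idempotent. Normalization depends
  on this: a unit entry of a tuple has to survive twisting.\<close>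

lemma D_one: "D \<one> = \<one>"
proof -
  have "D \<one> = D \<one> \<otimes> D \<one>"
    using difference[of \<one> \<one>] D_closed[of \<one>] by simp
  then show ?thesis
    using D_closed[of \<one>] by simp
qed

text \<open>The factor \<open>inv g\<close> of the difference identity cancels against the left
  factor of \<open>g \<otimes> h\<close>. For this reason the twisted representation is
  multiplicative and twisting commutes with faces.\<close>

lemma twist_mult:
  assumes "g \<in> carrier G" "h \<in> carrier G"
  shows "D (g \<otimes> h) \<otimes> (g \<otimes> h) = (D g \<otimes> g) \<otimes> (D h \<otimes> h)"
  using assms D_closed by (simp add: difference m_assoc) (simp add: inv_solve_left flip: m_assoc)

lemma twist_in_tuples: "g \<in> tuples G n \<Longrightarrow> twist G D n g \<in> tuples G n"
  using D_closed by (auto simp: twist_def tuples_def)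

lemma face_twist:
  assumes g: "g \<in> tuples G (n + 1)" and "i \<le> n + 1"
  shows "face G n i (twist G D (n + 1) g) = twist G D n (face G n i g)"
proof
  fix k
  show "face G n i (twist G D (n + 1) g) k = twist G D n (face G n i g) k"
  proof (cases "k \<in> {1..n}")
    case False
    then show ?thesis by (simp only: face_def twist_def restrict_apply if_False)
  next
    case k: True
    have "g k \<in> carrier G" "g (Suc k) \<in> carrier G"
      using k by (auto intro!: tuplesD[OF g])
    then show ?thesis
      using k by (cases k i rule: linorder_cases) (simp_all add: face_apply twist_def twist_mult)
  qed
qed

lemma smooth_twist_map: "smooth_map M M (\<lambda>g. D g \<otimes> g)"
proof (rule smooth_mult_compose[OF charted_manifold smooth_D])
  \<comment> \<open>The identity is smooth as the composite of inversion with itself.\<close>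
  have "smooth_map M M (\<lambda>x. inv (inv x))"
    by (rule smooth_map_compose[OF charted_manifold charted_manifold charted_manifold
          smooth_inv smooth_inv])
  then show "smooth_map M M (\<lambda>x. x)"
    by (rule smooth_map_cong[OF charted_manifold]) (simp_all add: topspace_eq charted_manifold)
qed

lemma smooth_twist: "smooth_map (power_manifold M n) (power_manifold M n) (twist G D n)"
proof -
  have "smooth_map (power_manifold M n) M (\<lambda>g. D (g i) \<otimes> g i)" if "i \<in> {1..n}" for i
    by (rule smooth_map_compose[OF charted_power charted_manifold charted_manifold
          smooth_coordinate[OF that] smooth_twist_map])
  from smooth_map_tuple[OF this] show ?thesis
    by (simp only: twist_def[abs_def])
qed

lemma graph_pullback_in_cochains:
  assumes \<alpha>: "\<alpha> \<in> cochains G M 2"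
  shows "graph_pullback G D \<alpha> \<in> cochains G M 1"
  unfolding cochains_def
proof (intro CollectI conjI ballI allI impI)
  let ?P = "power_manifold M 1"
  have 1: "smooth_map ?P M (\<lambda>g. g 1)"
    by (rule smooth_coordinate) simp
  have "smooth_map ?P M (\<lambda>g. D (g 1))"
    by (rule smooth_map_compose[OF charted_power charted_manifold charted_manifold 1 smooth_D])
  with 1 have "smooth_map ?P M (\<lambda>g. if i = 1 then D (g 1) else g 1)" for i :: nat
    by (cases "i = 1") simp_all
  from smooth_map_tuple[OF this, of 2] have "smooth_map ?P (power_manifold M 2) (\<lambda>g. tup [D (g 1), g 1])"
    by (simp only: tup_pair)
  from smooth_vec_compose[OF charted_power charted_power this cochainsD(1)[OF \<alpha>]]
  show "smooth_vec ?P (graph_pullback G D \<alpha>)"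
    by (rule smooth_vec_cong[OF charted_power]) (simp only: topspace_power graph_pullback_def if_True)
  show "graph_pullback G D \<alpha> g = 0" if "g \<notin> tuples G 1" for g
    using that by (simp add: graph_pullback_def)
  fix g assume g: "g \<in> tuples G 1" and "\<exists>i\<in>{1..1}. g i = \<one>"
  then have "g 1 = \<one>" by simp
  then have "\<alpha> (tup [D (g 1), g 1]) = 0"
    by (intro cochainsD(2)[OF \<alpha>, where i = 1]) (auto simp: tup_pair tuples_def D_one)
  then show "graph_pullback G D \<alpha> g = 0"
    by (simp add: graph_pullback_def)
qed

lemma twist_defect_in_cochains:
  assumes \<alpha>: "\<alpha> \<in> cochains G M n" and T: "bounded_linear T"
  shows "twist_defect G D T n \<alpha> \<in> cochains G M n"
  unfolding cochains_def
proof (intro CollectI conjI ballI allI impI)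
  let ?P = "power_manifold M n"
  note smooth = cochainsD(1)[OF \<alpha>]
  have "smooth_vec ?P (\<lambda>g. \<alpha> (twist G D n g) - T (\<alpha> g) - \<alpha> g)"
    by (intro smooth_vec_diff charted_power smooth_vec_bounded_linear[OF charted_power T] smooth
        smooth_vec_compose[OF charted_power charted_power smooth_twist])
  then show "smooth_vec ?P (twist_defect G D T n \<alpha>)"
    by (rule smooth_vec_cong[OF charted_power]) (simp only: topspace_power twist_defect_def if_True)
  show "twist_defect G D T n \<alpha> g = 0" if "g \<notin> tuples G n" for g
    using that by (simp add: twist_defect_def)
  fix g assume g: "g \<in> tuples G n" and "\<exists>i\<in>{1..n}. g i = \<one>"
  then obtain i where i: "i \<in> {1..n}" "g i = \<one>" by blast
  then have "twist G D n g i = \<one>"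
    by (simp add: twist_def D_one)
  then have "\<alpha> (twist G D n g) = 0" "\<alpha> g = 0"
    using i g by (auto intro: cochainsD(2)[OF \<alpha>] twist_in_tuples)
  then show "twist_defect G D T n \<alpha> g = 0"
    using linear_0[OF bounded_linear.linear[OF T]] by (simp add: twist_defect_def)
qed

end

section \<open>The two group coboundaries and the operator K\<close>

context difference_representation
begin

lemma bounded_linear_T: "bounded_linear T"
  using linear_T finite_dim linear_bounded_finite_span by blast

sublocale rep: smooth_representation G M \<Theta>
proof
  show mult: "\<Theta> (g \<otimes> h) = \<Theta> g o\<^sub>L \<Theta> h" if "g \<in> carrier G" "h \<in> carrier G" for g h
    using hom_mult[OF hom_rep that] by (simp add: GL_def)
  \<comment> \<open>\<open>hom\<close> speaks of the carrier and of products. That the unit acts as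
    the identity follows because its image is idempotent and has a left inverse in
    \<open>GL\<close>.\<close>
  obtain B where B: "B o\<^sub>L \<Theta> \<one> = id_blinfun"
    using hom_in_carrier[OF hom_rep one_closed] by (auto simp: GL_def)
  have "\<Theta> \<one> = (B o\<^sub>L \<Theta> \<one>) o\<^sub>L \<Theta> \<one>"
    by (simp add: B blinfun_eqI)
  also have "\<dots> = B o\<^sub>L (\<Theta> \<one> o\<^sub>L \<Theta> \<one>)"
    by (simp add: blinfun_eqI)
  also have "\<dots> = id_blinfun"
    using mult[of \<one> \<one>] B by simp
  finally show "\<Theta> \<one> = id_blinfun" .
  show "smooth_vec M \<Theta>" by (rule smooth_rep)
qed

sublocale twisted: smooth_representation G M "twisted_rep G D \<Theta>"
proof
  show "twisted_rep G D \<Theta> (g \<otimes> h) = twisted_rep G D \<Theta> g o\<^sub>L twisted_rep G D \<Theta> h"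
    if "g \<in> carrier G" "h \<in> carrier G" for g h
    using that by (simp add: twisted_rep_def twist_mult rep.rep_mult D_closed)
  show "twisted_rep G D \<Theta> \<one> = id_blinfun"
    by (simp add: twisted_rep_def D_one rep.rep_one)
  show "smooth_vec M (twisted_rep G D \<Theta>)"
    unfolding twisted_rep_def
    by (rule smooth_vec_compose[OF charted_manifold charted_manifold smooth_twist_map smooth_rep])
qed

abbreviation d where "d \<equiv> coboundary G \<Theta>"

abbreviation d\<^sub>D where "d\<^sub>D \<equiv> coboundary G (twisted_rep G D \<Theta>)"

text \<open>At the pair \<open>(D g, g)\<close> the coboundary of a 1-cochain has the terms
  \<open>\<Theta> (D g) (\<alpha> g)\<close>, \<open>- \<alpha> (D g \<otimes> g)\<close> and
  \<open>\<alpha> (D g)\<close>; K' consists of their negatives.\<close>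

lemma K_prime_1: "K_prime G D \<Theta> 1 \<alpha> = - graph_pullback G D (d 1 \<alpha>)"
proof
  fix g
  show "K_prime G D \<Theta> 1 \<alpha> g = (- graph_pullback G D (d 1 \<alpha>)) g"
  proof (cases "g \<in> tuples G 1")
    case True
    then have g1: "g 1 \<in> carrier G" by (rule tuplesD) simp
    then have "tup [D (g 1), g 1] \<in> tuples G (1 + 1)"
      using D_closed by (auto simp: tup_pair tuples_def)
    then show ?thesis
      using True g1
      by (simp add: K_prime_def graph_pullback_def coboundary_def)
        (simp add: tup_def restrict_def cong: if_cong)
  qed (simp add: K_prime_def graph_pullback_def)
qed

text \<open>The faces of \<open>(g 1, g 2)\<close> are \<open>g 2\<close>,
  \<open>g 1 \<otimes> g 2\<close> and \<open>g 1\<close>. Evaluating the pullback of \<alpha> at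
  each, with \<open>D (g 1) \<otimes> g 1\<close> acting on the first value, gives the terms of
  K'.\<close>

lemma K_prime_2: "K_prime G D \<Theta> 2 \<alpha> = d\<^sub>D 1 (graph_pullback G D \<alpha>)"
proof
  fix g
  show "K_prime G D \<Theta> 2 \<alpha> g = d\<^sub>D 1 (graph_pullback G D \<alpha>) g"
  proof (cases "g \<in> tuples G (1 + 1)")
    case True
    have mem: "g 1 \<in> carrier G" "g 2 \<in> carrier G"
      using True by (auto intro!: tuplesD[OF True])
    have face: "face G 1 i g \<in> tuples G 1" if "i \<le> 2" for i
      using face_in_tuples[OF True] that by simp
    have val: "face G 1 0 g 1 = g 2" "face G 1 1 g 1 = g 1 \<otimes> g 2" "face G 1 2 g 1 = g 1"
      by (simp_all add: face_def numeral_2_eq_2)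
    have "d\<^sub>D 1 (graph_pullback G D \<alpha>) g =
        coface G (twisted_rep G D \<Theta>) 1 0 (graph_pullback G D \<alpha>) g
        - coface G (twisted_rep G D \<Theta>) 1 1 (graph_pullback G D \<alpha>) g
        + coface G (twisted_rep G D \<Theta>) 1 2 (graph_pullback G D \<alpha>) g"
      unfolding coboundary_eq_sum_coface[OF True] by (simp add: numeral_2_eq_2)
    also have "\<dots> = K_prime G D \<Theta> 2 \<alpha> g"
      using True face[of 0] face[of 1] face[of 2] val
      by (simp add: coface_def graph_pullback_def K_prime_def twisted_rep_def numeral_2_eq_2)
    finally show ?thesis by simp
  next
    case False
    then show ?thesis by (simp add: K_prime_def coboundary_def numeral_2_eq_2)
  qed
qed

lemma K_prime_ge_3: "3 \<le> n \<Longrightarrow> K_prime G D \<Theta> n \<alpha> = 0"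
  by (auto simp: K_prime_def fun_eq_iff)

text \<open>The identity already holds coface by coface, as twisting commutes with faces. At index
  0, \<open>D (g 1) \<otimes> g 1\<close> is the first entry of the twisted tuple, which settles the
  first term of E; on the others \<open>compat\<close> moves its action past \<open>T + 1\<close>,
  where it becomes that of \<open>g 1\<close>.\<close>

lemma coboundary_twist_defect: "d\<^sub>D n (twist_defect G D T n \<alpha>) = twist_defect G D T (n + 1) (d n \<alpha>)"
proof
  fix g
  show "d\<^sub>D n (twist_defect G D T n \<alpha>) g = twist_defect G D T (n + 1) (d n \<alpha>) g"
  proof (cases "g \<in> tuples G (n + 1)")
    case False
    then show ?thesis by (simp add: coboundary_def twist_defect_def)
  next
    case g: True
    let ?g' = "twist G D (n + 1) g"
    have g': "?g' \<in> tuples G (n + 1)"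
      by (rule twist_in_tuples[OF g])
    have g1: "g 1 \<in> carrier G"
      by (rule tuplesD[OF g]) simp
    have coface: "coface G (twisted_rep G D \<Theta>) n i (twist_defect G D T n \<alpha>) g =
        coface G \<Theta> n i \<alpha> ?g' - T (coface G \<Theta> n i \<alpha> g) - coface G \<Theta> n i \<alpha> g"
      if i: "i \<le> n + 1" for i
    proof -
      let ?f = "face G n i g"
      have f: "?f \<in> tuples G n"
        by (rule face_in_tuples[OF g i])
      have "?g' 1 = D (g 1) \<otimes> g 1"
        by (simp add: twist_def)
      then show ?thesis
        using f face_twist[OF g i] compat[OF g1, of "\<alpha> ?f"]
        by (cases "i = 0")
          (simp_all add: coface_def twist_defect_def twisted_rep_def blinfun.diff_right blinfun.add_right algebra_simps)
    qed
    have "d\<^sub>D n (twist_defect G D T n \<alpha>) g = (\<Sum>i\<le>n + 1. (-1) ^ i *\<^sub>R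
        (coface G \<Theta> n i \<alpha> ?g' - T (coface G \<Theta> n i \<alpha> g) - coface G \<Theta> n i \<alpha> g))"
      unfolding coboundary_eq_sum_coface[OF g]
      by (intro sum.cong refl arg_cong[where f = "scaleR _"] coface) simp
    also have "\<dots> = d n \<alpha> ?g' - T (d n \<alpha> g) - d n \<alpha> g"
      unfolding coboundary_eq_sum_coface[OF g] coboundary_eq_sum_coface[OF g']
      by (simp only: scaleR_diff_right sum_subtractf linear_sum[OF linear_T] linear_scale[OF linear_T])
    finally show ?thesis
      using g by (simp only: twist_defect_def if_True)
  qed
qed

lemma K_map_in_cochains:
  assumes \<alpha>: "\<alpha> \<in> cochains G M n" and "n \<ge> 1"
  shows "K_map G D T \<Theta> n \<alpha> \<in> cochains G M n"
proof -
  have "K_prime G D \<Theta> n \<alpha> \<in> cochains G M n"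
  proof -
    consider "n = 1" | "n = 2" | "n \<ge> 3" using \<open>n \<ge> 1\<close> by linarith
    then show ?thesis
    proof cases
      case 1
      then show ?thesis
        using graph_pullback_in_cochains[of "d 1 \<alpha>"] rep.coboundary_in_cochains[OF \<alpha>]
        by (simp add: K_prime_1[unfolded One_nat_def] subspace_neg[OF subspace_cochains] numeral_2_eq_2)
    next
      case 2
      then show ?thesis
        using twisted.coboundary_in_cochains[OF graph_pullback_in_cochains[of \<alpha>]] \<alpha>
        by (simp add: K_prime_2 numeral_2_eq_2[symmetric])
    next
      case 3
      then show ?thesis
        by (simp add: K_prime_ge_3 subspace_0[OF subspace_cochains])
    qed
  qed
  moreover have "K_hat G D T n \<alpha> \<in> cochains G M n"
    unfolding K_hat_eq
    by (intro subspace_scale[OF subspace_cochains] twist_defect_in_cochains \<alpha> bounded_linear_T)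
  ultimately show ?thesis
    unfolding K_map_def by (rule subspace_add[OF subspace_cochains])
qed

lemma K_prime_add:
  assumes "n \<ge> 1"
  shows "K_prime G D \<Theta> n (\<alpha> + \<beta>) = K_prime G D \<Theta> n \<alpha> + K_prime G D \<Theta> n \<beta>"
proof -
  consider "n = 1" | "n = 2" | "n \<ge> 3" using assms by linarith
  then show ?thesis
    by cases (simp_all only: K_prime_1 K_prime_2 K_prime_ge_3 rep.coboundary_add
        twisted.coboundary_add graph_pullback_add minus_add_distrib add_0)
qed

lemma K_prime_scaleR:
  assumes "n \<ge> 1"
  shows "K_prime G D \<Theta> n (c *\<^sub>R \<alpha>) = c *\<^sub>R K_prime G D \<Theta> n \<alpha>"
proof -
  consider "n = 1" | "n = 2" | "n \<ge> 3" using assms by linarith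
  then show ?thesis
    by cases (simp_all only: K_prime_1 K_prime_2 K_prime_ge_3 rep.coboundary_scaleR
        twisted.coboundary_scaleR graph_pullback_scaleR scaleR_minus_right scaleR_zero_right)
qed

lemma K_map_add:
  "n \<ge> 1 \<Longrightarrow> K_map G D T \<Theta> n (\<alpha> + \<beta>) = K_map G D T \<Theta> n \<alpha> + K_map G D T \<Theta> n \<beta>"
  by (simp add: K_map_def K_prime_add K_hat_eq twist_defect_add[OF linear_T] scaleR_add_right
      add.assoc add.left_commute del: plus_fun_apply)

lemma K_map_scaleR: "n \<ge> 1 \<Longrightarrow> K_map G D T \<Theta> n (c *\<^sub>R \<alpha>) = c *\<^sub>R K_map G D T \<Theta> n \<alpha>"
  by (simp add: K_map_def K_prime_scaleR K_hat_eq twist_defect_scaleR[OF linear_T] scaleR_add_right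
      mult.commute)

text \<open>This is the one entry of \<delta> \<circ> \<delta> that is not the square of a group
  coboundary. The two summands of K satisfy it separately.\<close>

lemma coboundary_K_map:
  assumes "n \<ge> 1"
  shows "d\<^sub>D n (K_map G D T \<Theta> n \<alpha>) + K_map G D T \<Theta> (n + 1) (d n \<alpha>) = 0"
proof -
  have "d\<^sub>D n (K_prime G D \<Theta> n \<alpha>) + K_prime G D \<Theta> (n + 1) (d n \<alpha>) = 0"
  proof -
    consider "n = 1" | "n = 2" | "n \<ge> 3" using assms by linarith
    then show ?thesis
    proof cases
      case 1
      have "d\<^sub>D 1 (- graph_pullback G D (d 1 \<alpha>)) = - d\<^sub>D 1 (graph_pullback G D (d 1 \<alpha>))"
        using twisted.coboundary_scaleR[of 1 "-1"] by simp
      \<comment> \<open>Between degrees 1 and 2, K' changes from \<open>- \<iota> \<circ> d\<close>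
        to \<open>d\<^sub>D \<circ> \<iota>\<close>, so the two terms are negatives of each
        other.\<close>
      then show ?thesis
        unfolding 1 one_add_one K_prime_1 K_prime_2 by simp
    next
      \<comment> \<open>K' vanishes in degree 3, so a square of \<open>d\<^sub>D\<close> is all that
        remains.\<close>
      case 2
      have "d\<^sub>D 2 (d\<^sub>D 1 (graph_pullback G D \<alpha>)) = 0"
        using twisted.coboundary_coboundary[of 1] by (simp only: one_add_one)
      then show ?thesis
        unfolding 2 K_prime_2 by (simp add: K_prime_ge_3)
    next
      case 3
      have "d\<^sub>D n 0 = 0"
        using twisted.coboundary_scaleR[of n 0] by simp
      with 3 show ?thesis
        by (simp add: K_prime_ge_3)
    qed
  qed
  \<comment> \<open>Passing from degree \<open>n\<close> to \<open>n + 1\<close> flips the sign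
    \<open>(-1) ^ n\<close>; apart from it the two terms are equal.\<close>
  moreover have "d\<^sub>D n (K_hat G D T n \<alpha>) + K_hat G D T (n + 1) (d n \<alpha>) = 0"
    unfolding K_hat_eq twisted.coboundary_scaleR coboundary_twist_defect by simp
  ultimately show ?thesis
    unfolding K_map_def twisted.coboundary_add add.assoc add.left_commute[of "d\<^sub>D n (K_hat G D T n \<alpha>)"]
    by (simp only: add.assoc[symmetric] add_0_left)
qed

end

theorem theorem3p4:
  fixes G :: "('g, 'm) monoid_scheme"
    and M :: "'g manifold"
    and D :: "'g \<Rightarrow> 'g"
    and T :: "'v::real_normed_vector \<Rightarrow> 'v"
    and \<Theta> :: "'g \<Rightarrow> ('v \<Rightarrow>\<^sub>L 'v)"
  assumes "difference_representation G M D T \<Theta>"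
  shows "cochain_complex
           (difference_cochains G M ::
              nat \<Rightarrow> (((nat \<Rightarrow> 'g) \<Rightarrow> 'v) \<times> ((nat \<Rightarrow> 'g) \<Rightarrow> 'v)) set)
           (difference_coboundary G D T \<Theta>)"
proof -
  interpret difference_representation G M D T \<Theta> by fact
  let ?C = "difference_cochains G M :: nat \<Rightarrow> (((nat \<Rightarrow> 'g) \<Rightarrow> 'v) \<times> ((nat \<Rightarrow> 'g) \<Rightarrow> 'v)) set"
  let ?\<delta> = "difference_coboundary G D T \<Theta>"
  have sub: "subspace (second_cochains G M n :: ((nat \<Rightarrow> 'g) \<Rightarrow> 'v) set)" for n
    by (simp add: second_cochains_def subspace_cochains subspace_single_0)
  have \<delta>: "?\<delta> n (\<alpha>, \<beta>) = (d n \<alpha>, if n = 1 then K_map G D T \<Theta> n \<alpha>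
      else d\<^sub>D (n - 1) \<beta> + K_map G D T \<Theta> n \<alpha>)" for n \<alpha> \<beta>
    by (simp add: difference_coboundary_def)
  show ?thesis
    unfolding cochain_complex_def
  proof (intro allI impI conjI ballI)
    fix n :: nat assume n: "1 \<le> n"
    show "subspace (?C n)"
      unfolding difference_cochains_def by (intro subspace_Times subspace_cochains sub)
    show "?\<delta> n ` ?C n \<subseteq> ?C (n + 1)"
    proof (rule image_subsetI)
      fix x assume "x \<in> ?C n"
      then obtain \<alpha> \<beta> where x: "x = (\<alpha>, \<beta>)"
        and \<alpha>: "\<alpha> \<in> cochains G M n" and \<beta>: "\<beta> \<in> second_cochains G M n"
        by (cases x) (auto simp: difference_cochains_def)
      have "d\<^sub>D (n - 1) \<beta> \<in> cochains G M n" if "n \<noteq> 1"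
        using twisted.coboundary_in_cochains[of \<beta> "n - 1"] \<beta> that n by (simp add: second_cochains_def)
      then show "?\<delta> n x \<in> ?C (n + 1)"
        using rep.coboundary_in_cochains[OF \<alpha>] K_map_in_cochains[OF \<alpha> n] n
        by (cases "n = 1") (simp_all add: x \<delta> difference_cochains_def second_cochains_def subspace_add[OF subspace_cochains])
    qed
    fix x assume x: "x \<in> ?C n"
    obtain \<alpha> \<beta> where \<alpha>\<beta>: "x = (\<alpha>, \<beta>)" by (cases x)
    show "?\<delta> n (x + y) = ?\<delta> n x + ?\<delta> n y" for y
      using n by (cases y) (auto simp only: \<alpha>\<beta> \<delta> add_Pair rep.coboundary_add twisted.coboundary_add
          K_map_add if_True if_False ac_simps simp_thms split: if_split)
    show "?\<delta> n (c *\<^sub>R x) = c *\<^sub>R ?\<delta> n x" for c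
      using n by (auto simp only: \<alpha>\<beta> \<delta> scaleR_Pair rep.coboundary_scaleR twisted.coboundary_scaleR
          K_map_scaleR if_True if_False scaleR_add_right simp_thms split: if_split)
    have "d\<^sub>D n (K_map G D T \<Theta> n \<alpha>) + K_map G D T \<Theta> (n + 1) (d n \<alpha>) = 0"
      by (rule coboundary_K_map[OF n])
    \<comment> \<open>In degree 1 the operator has no \<beta>-term; in higher degrees \<beta>
      contributes a square of \<open>d\<^sub>D\<close>, the degrees matching by
      \<open>(n - 1) + 1 = n\<close>.\<close>
    moreover have "d\<^sub>D n (d\<^sub>D (n - 1) \<beta>) = 0" if "n \<noteq> 1"
      using twisted.coboundary_coboundary[of "n - 1" \<beta>] that n by simp
    ultimately show "?\<delta> (n + 1) (?\<delta> n x) = 0"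
      using n by (auto simp: \<alpha>\<beta> \<delta> rep.coboundary_coboundary[unfolded Suc_eq_plus1[symmetric]]
          twisted.coboundary_add zero_prod_def)
  qed
qed

end
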